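(* Let $E$ be a real Banach space, $[a,b]_{\mathbb{T}}$ a time scale interval and $u_0\in E$. Let $f:[a,b]_{\mathbb{T}}\times K_E[u_0,\beta]\to E$ for some $\beta>0$. Let $\mu_E$ be a sublinear measure of noncompactness in $E$, and let $w$ be a Kamke $\Delta$-function on $[a,b]_{\mathbb{T}}$. Assume that (i) the family $\{f(\cdot,x)\}_{x\in K_E[u_0,\beta]}$ is uniformly rd-equicontinuous on $[a,b]_{\mathbb{T}}$; (ii) the family $\{f(t,\cdot)\}_{t\in[a,b]_{\mathbb{T}}}$ is uniformly equicontinuous on $K_E[u_0,\beta]$; (iii) for some $M>0$, $\|f(t,x)\|_E\le M$ for all $(t,x)\in[a,b]_{\mathbb{T}}\times K_E[u_0,\beta]$; (iv) $\mu_E(f(t,X))\le w(t,\mu_E(X))$ for all $t\in[a,b]_{\mathbb{T}}$ and all $\emptyset\ne X\subseteq K_E[u_0,\beta]$, where $f(t,X)=\{f(t,x): x\in X\}$; (v) $\mu_E(\{u_0\})=0$. Then the initial value problem $$u^{\Delta}(t)=f(t,u(t)),\quad t\in[a,b]_{\mathbb{T}}^{\kappa},\qquad u(a)=u_0,$$ has a local solution on $[a,\sigma(b^{\star})]_{\mathbb{T}}$, where $b^{\star}\in[a,b]_{\mathbb{T}}$ is defined by $$b^{\star}:=\sup\left\{s\in\mathbb{T}:\ \sigma(s)\le\min\left\{b,\,a+\frac{\beta}{M}\right\}\right\}.$$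
   Context: **Time scales.** A time scale $\mathbb{T}$ is a non-empty closed subset of $\mathbb{R}$ with the topology inherited from $\mathbb{R}$. For $a,b\in\mathbb{T}$, $[a,b]_{\mathbb{T}}:=[a,b]\cap\mathbb{T}$ (similarly for open and half-open intervals). The forward and backward jump operators are $\sigma(t):=\inf\{s\in\mathbb{T}:s>t\}$ and $\rho(t):=\sup\{s\in\mathbb{T}:s<t\}$, with $\inf\emptyset:=\sup\mathbb{T}$, $\sup\emptyset:=\inf\mathbb{T}$. A point $t$ is right-dense if $\sigma(t)=t$, right-scattered if $\sigma(t)>t$, left-dense if $\rho(t)=t$, left-scattered if $\rho(t)<t$. $\mathbb{T}^\kappa$ is $\mathbb{T}$ with its maximum removed if $\mathbb{T}$ has a left-scattered maximum, and $\mathbb{T}^\kappa:=\mathbb{T}$ otherwise. Convention: when working on an interval $[a,b]_{\mathbb{T}}$, it is treated as if it were the whole time scale $\mathbb{T}$; in particular $\sigma(b)=b$ (so $b$ is right-dense), and $\inf\mathbb T=a$. The same convention applies to a subinterval $[a,c]_{\mathbb{T}}$ when functions are considered on it. For $\delta>0$, $\mathcal{O}^{\delta}_{\mathbb{T}}(t):=(t-\delta,t+\delta)\cap\mathbb{T}$. **$\Delta$-derivative.** $u:\mathbb{T}\to E$ is $\Delta$-differentiable at $t$ with $\Delta$-derivative $u^\Delta(t)\in E$ if for every $\varepsilon>0$ there is $\delta>0$ such that $\|u(\sigma(t))-u(s)-(\sigma(t)-s)u^{\Delta}(t)\|_E\le\varepsilon|\sigma(t)-s|$ for all $s\in\mathcal{O}^{\delta}_{\mathbb{T}}(t)$.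 (It is unique for $t\in\mathbb{T}^\kappa$; at a left-scattered maximum every vector is a $\Delta$-derivative.) **rd-continuity.** $u:\mathbb{T}\to E$ is rd-continuous if it is continuous at all right-dense points and has (finite) left-sided limits at all left-dense points. $C([a,b]_{\mathbb{T}},E)$ and $C_{rd}([a,b]_{\mathbb{T}},E)$ denote the continuous and the rd-continuous functions. $C^1_{rd}([a,b]_{\mathbb{T}},E)$ is the set of $u\in C([a,b]_{\mathbb{T}},E)$ such that $u^\Delta$ exists on $[a,b]_{\mathbb{T}}$ and $u^\Delta\in C_{rd}([a,b]_{\mathbb{T}},E)$ (at a left-scattered maximum the choice of $u^\Delta$ is irrelevant). **Local solution.** A local solution on $[a,c]_{\mathbb{T}}\subseteq[a,b]_{\mathbb{T}}$ is $u\in C^1_{rd}([a,c]_{\mathbb{T}},E)$ such that $u^\Delta(t)=f(t,u(t))$ for all $t\in[a,c]_{\mathbb{T}}^\kappa$ (in particular $(t,u(t))$ is in the domain of $f$ for these $t$) and $u(a)=u_0$. **Cauchy $\Delta$-integral.** If $U$ is $\Delta$-differentiable on $[a,b]_{\mathbb{T}}^\kappa$ with $U^\Delta=u$ there, then $\int_s^t u(\tau)\Delta\tau:=U(t)-U(s)$. Every rd-continuous function has such an antiderivative $U$. **Uniform (rd-)equicontinuity.** $K_E[x_0,r]$ is the closed ball in $E$ with centre $x_0$ and radius $r$. A family $Y$ of functions $[a,b]_{\mathbb{T}}\to E$ is uniformly rd-equicontinuous on $[a,b]_{\mathbb{T}}$ if for every $\varepsilon>0$ there exist $\delta_1,\dots,\delta_n>0$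 and $\tau_1,\dots,\tau_n\in[a,b]_{\mathbb{T}}$ with $a=\tau_1<\dots<\tau_n=b$ and $[a,b]_{\mathbb{T}}\subseteq\bigcup_{i=1}^n\mathcal{O}^{\delta_i}_{\mathbb{T}}(\tau_i)$ such that for all $u\in Y$, all $j=1,\dots,n$ and all $s,t\in\mathcal{O}^{\delta_j}_{\mathbb{T}}(\tau_j)$: if ($\tau_j$ is right-dense, or $s,t<\tau_j$, or $s,t\ge\tau_j$), then $\|u(s)-u(t)\|_E<\varepsilon$. A family of functions on a set $D$ of a metric space is uniformly equicontinuous if for each $\varepsilon>0$ there is one $\delta>0$ such that for all members $g$ of the family and all $x,y\in D$ at distance less than $\delta$, $g(x)$ and $g(y)$ are at distance less than $\varepsilon$. **Measures of noncompactness.** $\mathfrak{M}_E$ is the family of non-empty bounded subsets of $E$, $\mathfrak{N}_E$ the family of non-empty relatively compact subsets. A map $\mu:\mathfrak{M}_E\to[0,\infty)$ is a measure of noncompactness in $E$ if: (1) $\ker(\mu):=\{X\in\mathfrak{M}_E:\mu(X)=0\}$ is non-empty and $\ker(\mu)\subseteq\mathfrak{N}_E$; (2) $X\subseteq Y$ implies $\mu(X)\le\mu(Y)$; (3) $\mu(\operatorname{cl}X)=\mu(X)$; (4) $\mu(\operatorname{conv}X)=\mu(X)$; (5) $\mu(\lambda X+(1-\lambda)Y)\le\lambda\mu(X)+(1-\lambda)\mu(Y)$ for $\lambda\in[0,1]$; (6) if $X_k\in\mathfrak{M}_E$ are closed, $X_{k+1}\subseteq X_k$ for $k\ge1$, and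 $\mu(X_k)\to0$, then $\bigcap_{k=1}^\infty X_k\ne\emptyset$. It is sublinear if moreover $\mu(\lambda X)=|\lambda|\mu(X)$ for all $\lambda\in\mathbb{R}$ and $\mu(X+Y)\le\mu(X)+\mu(Y)$, for all $X,Y\in\mathfrak{M}_E$. **Kamke $\Delta$-function.** $w:[a,b]_{\mathbb{T}}\times[0,\infty)\to[0,\infty)$ is a Kamke $\Delta$-function on $[a,b]_{\mathbb{T}}$ if: (1) $w(\cdot,x)$ is rd-continuous on $[a,b]_{\mathbb{T}}$ for all $x\in[0,\infty)$; (2) the family $\{w(t,\cdot)\}_{t\in[a,b]_{\mathbb{T}}}$ is uniformly equicontinuous on $[0,x]$ for all $x\in(0,\infty)$; (3) $w(t,0)=0$ for all $t\in[a,b]_{\mathbb{T}}$; (4) $u\equiv0$ is the unique non-negative continuous function on $[a,b]_{\mathbb{T}}$ satisfying $u(t)\le\int_a^t w(s,u(s))\Delta s$ for all $t\in[a,b]_{\mathbb{T}}$ for which $u$ is $\Delta$-differentiable at $a$ and $u^\Delta(a)=0$. *)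

theory Defs
  imports "HOL-Analysis.Analysis"
begin

section \<open>Time scales\<close>

text \<open>
  All notions below take the time scale as an explicit set parameter.  Working on an interval
  means instantiating that parameter by \<open>ts_interval T a b\<close>, so the interval itself is the
  whole time scale; in particular \<open>ts_sigma (ts_interval T a b) b = b\<close>.
  Functions on a time scale are total functions on the reals of which only the values on the
  time scale matter.
\<close>

definition time_scale :: "real set \<Rightarrow> bool" where
  "time_scale T \<longleftrightarrow> closed T \<and> T \<noteq> {}"

definition ts_interval :: "real set \<Rightarrow> real \<Rightarrow> real \<Rightarrow> real set" where
  "ts_interval T a b = {a..b} \<inter> T"

text \<open>Infimum and supremum relative to a time scale: the infimum of the empty set is the supremum
  of \<open>T\<close>, and vice versa.\<close>

definition ts_inf :: "real set \<Rightarrow> real set \<Rightarrow> real" where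
  "ts_inf T S = (if S = {} then Sup T else Inf S)"

definition ts_sup :: "real set \<Rightarrow> real set \<Rightarrow> real" where
  "ts_sup T S = (if S = {} then Inf T else Sup S)"

definition ts_sigma :: "real set \<Rightarrow> real \<Rightarrow> real" where
  "ts_sigma T t = ts_inf T {s \<in> T. s > t}"

definition ts_rho :: "real set \<Rightarrow> real \<Rightarrow> real" where
  "ts_rho T t = ts_sup T {s \<in> T. s < t}"

definition right_dense :: "real set \<Rightarrow> real \<Rightarrow> bool" where
  "right_dense T t \<longleftrightarrow> ts_sigma T t = t"

definition left_dense :: "real set \<Rightarrow> real \<Rightarrow> bool" where
  "left_dense T t \<longleftrightarrow> ts_rho T t = t"

definition left_scattered :: "real set \<Rightarrow> real \<Rightarrow> bool" where
  "left_scattered T t \<longleftrightarrow> ts_rho T t < t"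

definition ts_kappa :: "real set \<Rightarrow> real set" where
  "ts_kappa T = T - {m \<in> T. (\<forall>s\<in>T. s \<le> m) \<and> left_scattered T m}"

definition ts_ball :: "real set \<Rightarrow> real \<Rightarrow> real \<Rightarrow> real set" where
  "ts_ball T \<delta> t = {t - \<delta><..<t + \<delta>} \<inter> T"


section \<open>Delta derivative, rd-continuity and the Cauchy delta integral\<close>

text \<open>The derivative is a relation because it is not unique at a left-scattered maximum.\<close>

definition has_delta_derivative ::
    "real set \<Rightarrow> (real \<Rightarrow> 'e::real_normed_vector) \<Rightarrow> 'e \<Rightarrow> real \<Rightarrow> bool" where
  "has_delta_derivative T u d t \<longleftrightarrow>
     (\<forall>\<epsilon>>0. \<exists>\<delta>>0. \<forall>s \<in> ts_ball T \<delta> t.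
        norm (u (ts_sigma T t) - u s - (ts_sigma T t - s) *\<^sub>R d) \<le> \<epsilon> * \<bar>ts_sigma T t - s\<bar>)"

definition rd_continuous_on :: "real set \<Rightarrow> (real \<Rightarrow> 'e::real_normed_vector) \<Rightarrow> bool" where
  "rd_continuous_on T u \<longleftrightarrow>
     (\<forall>t\<in>T. right_dense T t \<longrightarrow> continuous (at t within T) u) \<and>
     (\<forall>t\<in>T. left_dense T t \<longrightarrow> (\<exists>l. (u \<longlongrightarrow> l) (at t within (T \<inter> {..<t}))))"

definition C1_rd :: "real set \<Rightarrow> (real \<Rightarrow> 'e::real_normed_vector) set" where
  "C1_rd T = {u. continuous_on T u \<and>
     (\<exists>v. (\<forall>t\<in>T. has_delta_derivative T u (v t) t) \<and> rd_continuous_on T v)}"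

definition delta_antiderivative ::
    "real set \<Rightarrow> (real \<Rightarrow> 'e::real_normed_vector) \<Rightarrow> (real \<Rightarrow> 'e) \<Rightarrow> bool" where
  "delta_antiderivative T u U \<longleftrightarrow> (\<forall>t \<in> ts_kappa T. has_delta_derivative T U (u t) t)"

definition delta_integral ::
    "real set \<Rightarrow> real \<Rightarrow> real \<Rightarrow> (real \<Rightarrow> 'e::real_normed_vector) \<Rightarrow> 'e" where
  "delta_integral T s t u = (THE I. \<exists>U. delta_antiderivative T u U \<and> I = U t - U s)"


section \<open>Equicontinuity\<close>

definition uniformly_equicontinuous_on ::
    "'a::metric_space set \<Rightarrow> ('a \<Rightarrow> 'b::metric_space) set \<Rightarrow> bool" where
  "uniformly_equicontinuous_on D F \<longleftrightarrow>
     (\<forall>\<epsilon>>0. \<exists>\<delta>>0. \<forall>g\<in>F. \<forall>x\<in>D. \<forall>y\<in>D. dist x y < \<delta> \<longrightarrow> dist (g x) (g y) < \<epsilon>)"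

definition uniformly_rd_equicontinuous ::
    "real set \<Rightarrow> real \<Rightarrow> real \<Rightarrow> (real \<Rightarrow> 'e::real_normed_vector) set \<Rightarrow> bool" where
  "uniformly_rd_equicontinuous T a b Y \<longleftrightarrow>
     (let J = ts_interval T a b in
      \<forall>\<epsilon>>0. \<exists>n::nat. \<exists>\<delta> \<tau> :: nat \<Rightarrow> real.
        n \<ge> 1 \<and>
        (\<forall>i\<in>{1..n}. \<delta> i > 0 \<and> \<tau> i \<in> J) \<and>
        \<tau> 1 = a \<and> \<tau> n = b \<and> strict_mono_on {1..n} \<tau> \<and>
        J \<subseteq> (\<Union>i\<in>{1..n}. ts_ball J (\<delta> i) (\<tau> i)) \<and>
        (\<forall>u\<in>Y. \<forall>j\<in>{1..n}. \<forall>s \<in> ts_ball J (\<delta> j) (\<tau> j). \<forall>t \<in> ts_ball J (\<delta> j) (\<tau> j).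
           right_dense J (\<tau> j) \<or> (s < \<tau> j \<and> t < \<tau> j) \<or> (s \<ge> \<tau> j \<and> t \<ge> \<tau> j) \<longrightarrow>
           norm (u s - u t) < \<epsilon>))"


section \<open>Measures of noncompactness\<close>

text \<open>The domain of a measure of noncompactness consists of the non-empty bounded sets; its values
  on other sets are irrelevant.\<close>

definition nonempty_bounded :: "'e::real_normed_vector set set" where
  "nonempty_bounded = {X. X \<noteq> {} \<and> bounded X}"

definition nonempty_rel_compact :: "'e::real_normed_vector set set" where
  "nonempty_rel_compact = {X. X \<noteq> {} \<and> compact (closure X)}"

definition mnc_ker :: "('e::real_normed_vector set \<Rightarrow> real) \<Rightarrow> 'e set set" where
  "mnc_ker \<mu> = {X \<in> nonempty_bounded. \<mu> X = 0}"

definition measure_of_noncompactness :: "('e::real_normed_vector set \<Rightarrow> real) \<Rightarrow> bool" where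
  "measure_of_noncompactness \<mu> \<longleftrightarrow>
     (\<forall>X \<in> nonempty_bounded. \<mu> X \<ge> 0) \<and>
     mnc_ker \<mu> \<noteq> {} \<and> mnc_ker \<mu> \<subseteq> nonempty_rel_compact \<and>
     (\<forall>X \<in> nonempty_bounded. \<forall>Y \<in> nonempty_bounded. X \<subseteq> Y \<longrightarrow> \<mu> X \<le> \<mu> Y) \<and>
     (\<forall>X \<in> nonempty_bounded. \<mu> (closure X) = \<mu> X) \<and>
     (\<forall>X \<in> nonempty_bounded. \<mu> (convex hull X) = \<mu> X) \<and>
     (\<forall>X \<in> nonempty_bounded. \<forall>Y \<in> nonempty_bounded. \<forall>c\<in>{0..1}.
        \<mu> {c *\<^sub>R x + (1 - c) *\<^sub>R y | x y. x \<in> X \<and> y \<in> Y} \<le> c * \<mu> X + (1 - c) * \<mu> Y) \<and>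
     (\<forall>X :: nat \<Rightarrow> 'e set.
        (\<forall>k. X k \<in> nonempty_bounded \<and> closed (X k) \<and> X (Suc k) \<subseteq> X k) \<and>
        (\<lambda>k. \<mu> (X k)) \<longlonglongrightarrow> 0 \<longrightarrow> (\<Inter>k. X k) \<noteq> {})"

definition sublinear_mnc :: "('e::real_normed_vector set \<Rightarrow> real) \<Rightarrow> bool" where
  "sublinear_mnc \<mu> \<longleftrightarrow>
     measure_of_noncompactness \<mu> \<and>
     (\<forall>X \<in> nonempty_bounded. \<forall>c. \<mu> ((\<lambda>x. c *\<^sub>R x) ` X) = \<bar>c\<bar> * \<mu> X) \<and>
     (\<forall>X \<in> nonempty_bounded. \<forall>Y \<in> nonempty_bounded.
        \<mu> {x + y | x y. x \<in> X \<and> y \<in> Y} \<le> \<mu> X + \<mu> Y)"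


section \<open>Kamke delta functions and local solutions\<close>

definition kamke_delta :: "real set \<Rightarrow> real \<Rightarrow> real \<Rightarrow> (real \<Rightarrow> real \<Rightarrow> real) \<Rightarrow> bool" where
  "kamke_delta T a b w \<longleftrightarrow>
     (let J = ts_interval T a b in
      (\<forall>t\<in>J. \<forall>x\<ge>0. w t x \<ge> 0) \<and>
      (\<forall>x\<ge>0. rd_continuous_on J (\<lambda>t. w t x)) \<and>
      (\<forall>x>0. uniformly_equicontinuous_on {0..x} (w ` J)) \<and>
      (\<forall>t\<in>J. w t 0 = 0) \<and>
      (\<forall>u :: real \<Rightarrow> real.
         (continuous_on J u \<and> (\<forall>t\<in>J. u t \<ge> 0) \<and>
          (\<forall>t\<in>J. u t \<le> delta_integral J a t (\<lambda>s. w s (u s))) \<and>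
          has_delta_derivative J u 0 a)
         \<longleftrightarrow> (\<forall>t\<in>J. u t = 0)))"

text \<open>\<open>local_solution T a c K f u0 u\<close>: \<open>u\<close> is a solution on \<open>[a,c]\<close> (intersected with \<open>T\<close>) of the
  initial value problem whose right-hand side \<open>f\<close> is defined for second argument in \<open>K\<close>.\<close>

definition local_solution ::
    "real set \<Rightarrow> real \<Rightarrow> real \<Rightarrow> 'e::real_normed_vector set \<Rightarrow> (real \<Rightarrow> 'e \<Rightarrow> 'e) \<Rightarrow> 'e \<Rightarrow>
     (real \<Rightarrow> 'e) \<Rightarrow> bool" where
  "local_solution T a c K f u0 u \<longleftrightarrow>
     (let J = ts_interval T a c in
      u \<in> C1_rd J \<and>
      (\<forall>t \<in> ts_kappa J. u t \<in> K \<and> has_delta_derivative J u (f t (u t)) t) \<and>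
      u a = u0)"

end

theory Submission
  imports Defs "HOL-Library.Diagonal_Subsequence"
begin

text \<open>
  Composing with the floor map \<open>x \<mapsto> max {s \<in> J. s \<le> x}\<close> turns the delta integral into an
  ordinary one, so the problem becomes \<open>u t = u0 + \<integral>\<^sub>a\<^sup>t f (\<pi> s) (u (\<pi> s)) ds\<close>.  Tonelli's delayed
  equations have exact solutions \<open>u\<^sub>n\<close>, which are \<open>M\<close>-Lipschitz and stay in the ball up to \<open>bstar\<close>.
  A sublinear measure of noncompactness is Lipschitz for the Hausdorff distance, so
  \<open>v\<^sub>k t = \<mu> {u\<^sub>n t | n \<ge> k}\<close> is Lipschitz in \<open>t\<close>, and subadditivity applied to Riemann sums gives
  \<open>v\<^sub>k t \<le> \<integral>\<^sub>a\<^sup>t w (\<pi> s) (v\<^sub>k (\<pi> s)) ds + o(1)\<close>.  The decreasing limit of the \<open>v\<^sub>k\<close> vanishes by the Kamke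
  condition.  Hence every subsequence of \<open>u\<^sub>n t\<close> has a cluster point, and a diagonal argument yields
  a uniform limit, which solves the equation; no fixed-point theorem is needed.  A right-scattered
  \<open>bstar\<close> only costs one more explicit step.
\<close>

section \<open>Compact time scales\<close>

text \<open>The ball of radius \<beta> confines M-Lipschitz functions starting at \<open>u0\<close>
  only up to \<open>bstar\<close>, whereas the Kamke condition concerns functions on all of [a,b].
  The integrals that define the approximations therefore stop at \<open>clamp t\<close>, so that the
  approximations stay constant beyond \<open>bstar\<close>. Since w is non-negative, the limiting
  inequality survives when its integral is extended to all of [a,t], and the uniqueness condition
  applies on the whole interval. The step to the jump of \<open>bstar\<close> is added only after
  the limit has been taken.

  The other obstacle is that the right-hand side is merely rd-continuous in time. Estimating the
  measure of a whole family of integrals by Riemann sums requires one partition for all members.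
  This is why equicontinuity is carried for families, as one-sided Cauchy conditions: they pass
  through the floor map even at gaps, and the local estimates they give are glued by the Bolzano
  bisection principle.\<close>

text \<open>The left-hand condition is a Cauchy condition: for a single function it says that the left
  limit exists, and it is vacuous at left-scattered points.\<close>

definition equi_rd_at :: "real set \<Rightarrow> (real \<Rightarrow> 'e::real_normed_vector) set \<Rightarrow> real \<Rightarrow> bool" where
  "equi_rd_at J F t \<longleftrightarrow> (\<forall>\<epsilon>>0. \<exists>\<delta>>0. \<forall>g\<in>F.
     (right_dense J t \<longrightarrow> (\<forall>s\<in>J. \<bar>s - t\<bar> < \<delta> \<longrightarrow> norm (g s - g t) < \<epsilon>)) \<and>
     (\<forall>s\<in>J. \<forall>s'\<in>J. t - \<delta> < s \<and> s < t \<and> t - \<delta> < s' \<and> s' < t \<longrightarrow> norm (g s - g s') < \<epsilon>))"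

lemma equi_rd_atE:
  assumes "equi_rd_at J F t" "\<epsilon> > 0"
  obtains \<delta> where "\<delta> > 0"
    "\<And>g s. g \<in> F \<Longrightarrow> right_dense J t \<Longrightarrow> s \<in> J \<Longrightarrow> \<bar>s - t\<bar> < \<delta> \<Longrightarrow> norm (g s - g t) < \<epsilon>"
    "\<And>g s s'. g \<in> F \<Longrightarrow> s \<in> J \<Longrightarrow> s' \<in> J \<Longrightarrow> t - \<delta> < s \<Longrightarrow> s < t \<Longrightarrow> t - \<delta> < s' \<Longrightarrow> s' < t
      \<Longrightarrow> norm (g s - g s') < \<epsilon>"
proof -
  obtain \<delta> where d: "\<delta> > 0" "\<forall>g\<in>F.
     (right_dense J t \<longrightarrow> (\<forall>s\<in>J. \<bar>s - t\<bar> < \<delta> \<longrightarrow> norm (g s - g t) < \<epsilon>)) \<and>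
     (\<forall>s\<in>J. \<forall>s'\<in>J. t - \<delta> < s \<and> s < t \<and> t - \<delta> < s' \<and> s' < t \<longrightarrow> norm (g s - g s') < \<epsilon>)"
    using assms(1)[unfolded equi_rd_at_def, rule_format, OF assms(2)] by (elim exE conjE)
  show ?thesis by (rule that[OF d(1)]) (use d(2) in blast)+
qed

lemma equi_rd_at_mono: "equi_rd_at J G t \<Longrightarrow> F \<subseteq> G \<Longrightarrow> equi_rd_at J F t"
  unfolding equi_rd_at_def by (meson subsetD)

lemma uniformly_equicontinuous_onE:
  assumes "uniformly_equicontinuous_on D F" "\<epsilon> > 0"
  obtains \<delta> where "\<delta> > 0"
    "\<And>g x y. g \<in> F \<Longrightarrow> x \<in> D \<Longrightarrow> y \<in> D \<Longrightarrow> dist x y < \<delta> \<Longrightarrow> dist (g x) (g y) < \<epsilon>"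
  using assms unfolding uniformly_equicontinuous_on_def by meson

text \<open>Nothing is asked of the value at \<open>x\<close> itself: composition with the floor map
  creates jumps there, and a single point does not affect an integral. For one function into a
  Banach space the condition amounts to the existence of both one-sided limits everywhere.\<close>

definition equi_regulated :: "(real \<Rightarrow> 'e::real_normed_vector) set \<Rightarrow> bool" where
  "equi_regulated G \<longleftrightarrow> (\<forall>x. \<forall>\<epsilon>>0. \<exists>\<delta>>0. \<forall>g\<in>G. \<forall>s s'.
     (x < s \<and> s < x + \<delta> \<and> x < s' \<and> s' < x + \<delta> \<or>
      x - \<delta> < s \<and> s < x \<and> x - \<delta> < s' \<and> s' < x) \<longrightarrow> norm (g s - g s') < \<epsilon>)"

text \<open>The \<open>max\<close> makes the map total with values in \<open>J\<close>: points to the left of \<open>J\<close> are sent to its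
  minimum instead of \<open>Sup {}\<close>.\<close>

definition ts_floor :: "real set \<Rightarrow> real \<Rightarrow> real" where
  "ts_floor J x = Sup (J \<inter> {..max (Inf J) x})"

text \<open>The interval is abstract because the locale is instantiated twice: for the whole
  interval and for the shorter one that ends at the jump of \<open>bstar\<close>, whose own jump
  operator may differ at its right end.\<close>

locale compact_time_scale =
  fixes J :: "real set" and a b :: real
  assumes closed: "closed J" and sub: "J \<subseteq> {a..b}" and a_in: "a \<in> J" and b_in: "b \<in> J"
begin

lemma in_bounds: "t \<in> J \<Longrightarrow> a \<le> t" "t \<in> J \<Longrightarrow> t \<le> b"
  using sub by auto

lemma Inf_J: "Inf J = a"
  using a_in in_bounds by (intro cInf_eq_minimum) auto

lemma Sup_J: "Sup J = b"
  using b_in in_bounds by (intro cSup_eq_maximum) auto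

lemma a_le_b: "a \<le> b"
  using in_bounds(1)[OF b_in] .

lemma compact_J: "compact J"
  using closed sub by (meson bounded_closed_interval bounded_subset compact_eq_bounded_closed)

lemma bdd: "S \<subseteq> J \<Longrightarrow> bdd_above S" "S \<subseteq> J \<Longrightarrow> bdd_below S"
  using sub by (meson bdd_above_Icc bdd_below_Icc bdd_above_mono bdd_below_mono)+

lemma sigma_b: "ts_sigma J b = b"
proof -
  have e: "{s \<in> J. s > b} = {}" using in_bounds by fastforce
  show ?thesis unfolding ts_sigma_def ts_inf_def e by (simp add: Sup_J)
qed

lemma sigma_less_b:
  assumes "t < b" shows "ts_sigma J t = Inf {s \<in> J. s > t}"
  using assms b_in by (auto simp: ts_sigma_def ts_inf_def)

lemma sigma_in:
  assumes "t \<in> J" shows "ts_sigma J t \<in> J"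
proof (cases "t = b")
  case False
  then have "t < b" using in_bounds[OF assms] by simp
  then show ?thesis
    unfolding sigma_less_b[OF \<open>t < b\<close>] using b_in
    by (intro closed_subset_contains_Inf[OF closed] bdd) auto
qed (simp add: sigma_b b_in)

lemma sigma_ge:
  assumes "t \<in> J" shows "t \<le> ts_sigma J t"
proof (cases "t = b")
  case False
  then have "t < b" using in_bounds[OF assms] by simp
  then show ?thesis
    unfolding sigma_less_b[OF \<open>t < b\<close>] using b_in by (intro cInf_greatest) auto
qed (simp add: sigma_b)

lemma sigma_le:
  assumes "s \<in> J" "t < s" shows "ts_sigma J t \<le> s"
proof -
  have "t < b" using assms in_bounds[of s] by simp
  show ?thesis
    unfolding sigma_less_b[OF \<open>t < b\<close>] using assms by (intro cInf_lower bdd) auto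
qed

text \<open>The end point \<open>b\<close> has to be excluded: it is right-dense by convention, with
  no point of \<open>J\<close> to its right.\<close>

lemma right_dense_approx:
  assumes "right_dense J t" "t \<in> J" "t < b" "\<delta> > 0"
  obtains s where "s \<in> J" "t < s" "s < t + \<delta>"
proof -
  have "Inf {s \<in> J. s > t} < t + \<delta>"
    using assms sigma_less_b[of t] by (simp add: right_dense_def)
  then obtain s where "s \<in> {s \<in> J. s > t}" "s < t + \<delta>"
    using cInf_lessD[of "{s \<in> J. s > t}" "t + \<delta>"] b_in assms by auto
  then show ?thesis using that by auto
qed

lemma right_denseI:
  assumes "t \<in> J" "\<And>\<delta>. \<delta> > 0 \<Longrightarrow> \<exists>s\<in>J. t < s \<and> s < t + \<delta>"
  shows "right_dense J t"
proof (rule ccontr)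
  assume "\<not> right_dense J t"
  then have "ts_sigma J t > t" using sigma_ge[OF assms(1)] by (simp add: right_dense_def)
  then obtain s where "s \<in> J" "t < s" "s < ts_sigma J t"
    using assms(2)[of "ts_sigma J t - t"] by auto
  then show False using sigma_le[of s t] by simp
qed

lemma not_left_dense_gap:
  assumes "\<not> left_dense J t" "t \<in> J"
  obtains \<delta> where "\<delta> > 0" "J \<inter> {t - \<delta><..<t} = {}"
proof (cases "{s \<in> J. s < t} = {}")
  case True
  then show ?thesis by (intro that[of 1]) auto
next
  case False
  let ?r = "Sup {s \<in> J. s < t}"
  have "?r \<le> t" using False by (intro cSup_least) auto
  moreover have "?r \<noteq> t"
    using assms(1) False by (simp only: left_dense_def ts_rho_def ts_sup_def if_False) simp
  moreover have "s \<le> ?r" if "s \<in> J" "s < t" for s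
    using that by (intro cSup_upper bdd) auto
  ultimately show ?thesis using that[of "t - ?r"] by fastforce
qed

lemma in_kappa:
  assumes "t \<in> J" "t < b \<or> left_dense J t" shows "t \<in> ts_kappa J"
  using assms b_in by (force simp: ts_kappa_def left_scattered_def left_dense_def)

abbreviation \<pi> :: "real \<Rightarrow> real" where "\<pi> \<equiv> ts_floor J"

lemma floor_ge: "s \<in> J \<Longrightarrow> s \<le> x \<Longrightarrow> s \<le> \<pi> x"
  unfolding ts_floor_def by (intro cSup_upper bdd) auto

lemma floor_in: "\<pi> x \<in> J"
  unfolding ts_floor_def
  using a_in Inf_J by (intro closed_subset_contains_Sup[OF closed] bdd) auto

lemma floor_le: "a \<le> x \<Longrightarrow> \<pi> x \<le> x"
  unfolding ts_floor_def Inf_J using a_in by (intro cSup_least) auto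

lemma floor_id: "s \<in> J \<Longrightarrow> \<pi> s = s"
  using floor_ge[of s s] floor_le[of s] in_bounds by force

lemma floor_const:
  assumes "J \<inter> {p<..s} = {}" "p \<le> s" shows "\<pi> s = \<pi> p"
proof -
  have "J \<inter> {..max a s} = J \<inter> {..max a p}"
    using assms a_in by (force simp: max_def)
  then show ?thesis by (simp add: ts_floor_def Inf_J)
qed

lemma floor_left:
  assumes "t \<in> J" "t \<le> x" "x < ts_sigma J t" shows "\<pi> x = t"
proof -
  have "J \<inter> {t<..x} = {}" using sigma_le assms by force
  then show ?thesis using floor_const[of t x] floor_id assms by simp
qed

section \<open>Rd-continuity and rd-equicontinuity as pointwise one-sided Cauchy conditions\<close>

lemma rd_continuous_imp_equi_rd_at:
  assumes "rd_continuous_on J g" "t \<in> J" shows "equi_rd_at J {g} t"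
  unfolding equi_rd_at_def
proof (intro allI impI)
  fix \<epsilon> :: real assume e: "\<epsilon> > 0"
  have "\<exists>\<delta>>0. right_dense J t \<longrightarrow> (\<forall>s\<in>J. \<bar>s - t\<bar> < \<delta> \<longrightarrow> norm (g s - g t) < \<epsilon>)"
  proof (cases "right_dense J t")
    case True
    then have "continuous (at t within J) g" using assms by (auto simp: rd_continuous_on_def)
    then show ?thesis using e
      unfolding continuous_within_eps_delta by (auto simp: dist_norm)
  qed (auto intro: exI[of _ 1])
  then obtain d1 where d1: "d1 > 0"
    "right_dense J t \<Longrightarrow> s \<in> J \<Longrightarrow> \<bar>s - t\<bar> < d1 \<Longrightarrow> norm (g s - g t) < \<epsilon>" for s
    by blast
  have "\<exists>\<delta>>0. \<forall>s\<in>J. \<forall>s'\<in>J. t - \<delta> < s \<and> s < t \<and> t - \<delta> < s' \<and> s' < t \<longrightarrow> norm (g s - g s') < \<epsilon>"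
  proof (cases "left_dense J t")
    case True
    then obtain l where "(g \<longlongrightarrow> l) (at t within (J \<inter> {..<t}))"
      using assms by (auto simp: rd_continuous_on_def)
    then obtain \<delta> where d: "\<delta> > 0"
      "\<And>s. s \<in> J \<Longrightarrow> s < t \<Longrightarrow> \<bar>s - t\<bar> < \<delta> \<Longrightarrow> dist (g s) l < \<epsilon> / 2"
      using e unfolding Lim_within by (metis IntI dist_real_def half_gt_zero lessThan_iff less_irrefl zero_less_abs_iff right_minus_eq)
    show ?thesis
    proof (intro exI[of _ \<delta>] conjI ballI impI)
      fix s s' assume "s \<in> J" "s' \<in> J" "t - \<delta> < s \<and> s < t \<and> t - \<delta> < s' \<and> s' < t"
      then have "dist (g s) l < \<epsilon> / 2" "dist (g s') l < \<epsilon> / 2" using d(2) by auto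
      then show "norm (g s - g s') < \<epsilon>"
        using dist_triangle_half_l dist_norm by metis
    qed (use d in simp)
  next
    case False
    then obtain \<delta> where "\<delta> > 0" "J \<inter> {t - \<delta><..<t} = {}"
      using not_left_dense_gap assms(2) by blast
    then show ?thesis by (intro exI[of _ \<delta>]) auto
  qed
  then obtain d2 where d2: "d2 > 0" "\<And>s s'. s \<in> J \<Longrightarrow> s' \<in> J \<Longrightarrow>
    t - d2 < s \<Longrightarrow> s < t \<Longrightarrow> t - d2 < s' \<Longrightarrow> s' < t \<Longrightarrow> norm (g s - g s') < \<epsilon>"
    by blast
  show "\<exists>\<delta>>0. \<forall>g\<in>{g}.
     (right_dense J t \<longrightarrow> (\<forall>s\<in>J. \<bar>s - t\<bar> < \<delta> \<longrightarrow> norm (g s - g t) < \<epsilon>)) \<and>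
     (\<forall>s\<in>J. \<forall>s'\<in>J. t - \<delta> < s \<and> s < t \<and> t - \<delta> < s' \<and> s' < t \<longrightarrow> norm (g s - g s') < \<epsilon>)"
    using d1 d2 by (intro exI[of _ "min d1 d2"]) auto
qed

text \<open>Completeness turns the Cauchy condition into a left limit: a limit found along one
  sequence approaching \<open>t\<close> from the left is, again by the Cauchy condition, the limit
  of the function.\<close>

lemma equi_rd_at_imp_rd_continuous:
  fixes g :: "real \<Rightarrow> 'e::banach"
  assumes "\<And>t. t \<in> J \<Longrightarrow> equi_rd_at J {g} t" shows "rd_continuous_on J g"
  unfolding rd_continuous_on_def
proof (intro conjI ballI impI)
  fix t assume t: "t \<in> J" "right_dense J t"
  show "continuous (at t within J) g"
    unfolding continuous_within_eps_delta
  proof (intro allI impI)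
    fix \<epsilon> :: real assume "\<epsilon> > 0"
    then obtain \<delta> where "\<delta> > 0" "\<forall>s\<in>J. \<bar>s - t\<bar> < \<delta> \<longrightarrow> norm (g s - g t) < \<epsilon>"
      using assms[OF t(1)] t(2) unfolding equi_rd_at_def by auto
    then show "\<exists>d>0. \<forall>x'\<in>J. dist x' t < d \<longrightarrow> dist (g x') (g t) < \<epsilon>"
      by (auto simp: dist_norm intro!: exI[of _ \<delta>])
  qed
next
  fix t assume t: "t \<in> J" "left_dense J t"
  let ?L = "J \<inter> {..<t}"
  have C: "\<exists>\<delta>>0. \<forall>s\<in>?L. \<forall>s'\<in>?L. t - \<delta> < s \<and> t - \<delta> < s' \<longrightarrow> norm (g s - g s') < \<epsilon>"
    if "\<epsilon> > 0" for \<epsilon>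
  proof -
    obtain \<delta> where "\<delta> > 0" "\<forall>s\<in>J. \<forall>s'\<in>J. t - \<delta> < s \<and> s < t \<and> t - \<delta> < s' \<and> s' < t \<longrightarrow> norm (g s - g s') < \<epsilon>"
      using assms[OF t(1)] \<open>\<epsilon> > 0\<close> unfolding equi_rd_at_def by auto
    then show ?thesis by (intro exI[of _ \<delta>]) auto
  qed
  show "\<exists>l. (g \<longlongrightarrow> l) (at t within ?L)"
  proof (cases "t islimpt ?L")
    \<comment> \<open>Only the minimum \<open>a\<close> gets here: it is left-dense because the
      supremum of the empty set is \<open>Inf J\<close>, yet nothing lies to its left, so the filter
      is trivial.\<close>
    case False
    then have "at t within ?L = bot" using trivial_limit_within by blast
    then show ?thesis by (metis tendsto_bot)
  next
    case True
    then obtain x where x: "\<And>n. x n \<in> ?L" "x \<longlonglongrightarrow> t"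
      by (auto simp: islimpt_sequential)
    have near: "\<exists>N. \<forall>n\<ge>N. t - \<delta> < x n" if "\<delta> > 0" for \<delta>
      using order_tendstoD(1)[OF x(2), of "t - \<delta>"] that by (auto simp: eventually_sequentially)
    have "Cauchy (\<lambda>n. g (x n))"
      unfolding Cauchy_def
    proof (intro allI impI)
      fix \<epsilon> :: real assume "\<epsilon> > 0"
      then obtain \<delta> where d: "\<delta> > 0" "\<forall>s\<in>?L. \<forall>s'\<in>?L. t - \<delta> < s \<and> t - \<delta> < s' \<longrightarrow> norm (g s - g s') < \<epsilon>"
        using C by blast
      then obtain N where "\<forall>n\<ge>N. t - \<delta> < x n" using near by blast
      then show "\<exists>N. \<forall>m\<ge>N. \<forall>n\<ge>N. dist (g (x m)) (g (x n)) < \<epsilon>"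
        using d(2) x(1) by (auto simp: dist_norm intro!: exI[of _ N])
    qed
    then obtain l where l: "(\<lambda>n. g (x n)) \<longlonglongrightarrow> l"
      using Cauchy_convergent_iff convergent_def by blast
    have "(g \<longlongrightarrow> l) (at t within ?L)"
      unfolding Lim_within
    proof (intro allI impI)
      fix \<epsilon> :: real assume e: "\<epsilon> > 0"
      then obtain \<delta> where d: "\<delta> > 0" "\<forall>s\<in>?L. \<forall>s'\<in>?L. t - \<delta> < s \<and> t - \<delta> < s' \<longrightarrow> norm (g s - g s') < \<epsilon> / 2"
        using C[of "\<epsilon> / 2"] by auto
      obtain N where N: "\<forall>n\<ge>N. t - \<delta> < x n" using near d by blast
      obtain N' where "\<forall>n\<ge>N'. dist (g (x n)) l < \<epsilon> / 2"
        using l e unfolding lim_sequentially by (meson half_gt_zero)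
      with N have n: "t - \<delta> < x (max N N')" "dist (g (x (max N N'))) l < \<epsilon> / 2" by auto
      have "dist (g s) l < \<epsilon>" if "s \<in> ?L" "dist s t < \<delta>" for s
      proof -
        have "t - \<delta> < s" using that by (auto simp: dist_real_def)
        then have "dist (g s) (g (x (max N N'))) < \<epsilon> / 2"
          using d(2) that(1) x(1) n(1) by (auto simp: dist_norm)
        then show ?thesis using n(2) dist_triangle[of "g s" l "g (x (max N N'))"] by simp
      qed
      then show "\<exists>d>0. \<forall>x\<in>?L. 0 < dist x t \<and> dist x t < d \<longrightarrow> dist (g x) l < \<epsilon>"
        using d(1) by blast
    qed
    then show ?thesis ..
  qed
qed

lemma uniformly_rd_equicontinuous_imp_equi_rd_at:
  assumes "uniformly_rd_equicontinuous T p q Y" "J = ts_interval T p q" "t \<in> J"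
  shows "equi_rd_at J Y t"
  unfolding equi_rd_at_def
proof (intro allI impI)
  fix \<epsilon> :: real assume "\<epsilon> > 0"
  then obtain n :: nat and d \<tau> :: "nat \<Rightarrow> real" where
    cov: "J \<subseteq> (\<Union>i\<in>{1..n}. ts_ball J (d i) (\<tau> i))" and
    osc: "\<forall>u\<in>Y. \<forall>j\<in>{1..n}. \<forall>s \<in> ts_ball J (d j) (\<tau> j). \<forall>t \<in> ts_ball J (d j) (\<tau> j).
           right_dense J (\<tau> j) \<or> (s < \<tau> j \<and> t < \<tau> j) \<or> (s \<ge> \<tau> j \<and> t \<ge> \<tau> j) \<longrightarrow>
           norm (u s - u t) < \<epsilon>"
    using assms(1)[unfolded uniformly_rd_equicontinuous_def assms(2)[symmetric] Let_def, rule_format, OF \<open>\<epsilon> > 0\<close>]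
    by (elim exE conjE) (rule that)
  obtain j where j: "j \<in> {1..n}" "t \<in> ts_ball J (d j) (\<tau> j)"
    using cov assms(3) by blast
  \<comment> \<open>The first bound keeps the neighbourhood of \<open>t\<close> inside the j-th
    ball. The second keeps it on one side of \<open>\<tau> j\<close> unless
    \<open>t = \<tau> j\<close>; in that case left neighbours lie strictly below
    \<open>\<tau> j\<close>, and right-density of \<open>t\<close> is right-density of
    \<open>\<tau> j\<close>.\<close>
  define \<delta> where "\<delta> = min (d j - \<bar>t - \<tau> j\<bar>) (if t = \<tau> j then 1 else \<bar>t - \<tau> j\<bar>)"
  have pos: "\<delta> > 0" using j(2) by (auto simp: \<delta>_def ts_ball_def)
  have ball: "s \<in> ts_ball J (d j) (\<tau> j)" if "s \<in> J" "\<bar>s - t\<bar> < \<delta>" for s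
    using that by (auto simp: \<delta>_def ts_ball_def)
  have osc': "norm (g s - g s') < \<epsilon>" if "g \<in> Y" "s \<in> J" "s' \<in> J" "\<bar>s - t\<bar> < \<delta>" "\<bar>s' - t\<bar> < \<delta>"
    "right_dense J (\<tau> j) \<or> (s < \<tau> j \<and> s' < \<tau> j) \<or> (s \<ge> \<tau> j \<and> s' \<ge> \<tau> j)" for g s s'
    using osc j(1) ball that by blast
  have "norm (g s - g t) < \<epsilon>" if "g \<in> Y" "s \<in> J" "\<bar>s - t\<bar> < \<delta>" "right_dense J t" for g s
  proof (rule osc'[OF that(1,2) assms(3) that(3)])
    show "right_dense J (\<tau> j) \<or> (s < \<tau> j \<and> t < \<tau> j) \<or> (s \<ge> \<tau> j \<and> t \<ge> \<tau> j)"
      using that(3,4) by (cases "t = \<tau> j") (auto simp: \<delta>_def)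
  qed (use pos in simp)
  moreover have "norm (g s - g s') < \<epsilon>" if "g \<in> Y" "s \<in> J" "s' \<in> J"
    "t - \<delta> < s" "s < t" "t - \<delta> < s'" "s' < t" for g s s'
  proof (rule osc'[OF that(1-3)])
    show "right_dense J (\<tau> j) \<or> (s < \<tau> j \<and> s' < \<tau> j) \<or> (s \<ge> \<tau> j \<and> s' \<ge> \<tau> j)"
      using that(4-) by (cases "t = \<tau> j") (auto simp: \<delta>_def)
  qed (use that in auto)
  ultimately show "\<exists>\<delta>>0. \<forall>g\<in>Y.
     (right_dense J t \<longrightarrow> (\<forall>s\<in>J. \<bar>s - t\<bar> < \<delta> \<longrightarrow> norm (g s - g t) < \<epsilon>)) \<and>
     (\<forall>s\<in>J. \<forall>s'\<in>J. t - \<delta> < s \<and> s < t \<and> t - \<delta> < s' \<and> s' < t \<longrightarrow> norm (g s - g s') < \<epsilon>)"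
    using pos by blast
qed

text \<open>On each side of a real point \<open>x\<close> there are two possibilities. Either
  \<open>J\<close> has a gap there, on which the floor map is constant; or \<open>J\<close>
  accumulates at \<open>x\<close> from that side, so that \<open>x\<close> lies in \<open>J\<close>
  and the floors of nearby points are points of \<open>J\<close> near \<open>x\<close> on the same
  side, where the condition at \<open>x\<close> applies.\<close>

lemma equi_regulated_floor:
  assumes "\<And>t. t \<in> J \<Longrightarrow> equi_rd_at J F t"
  shows "equi_regulated ((\<lambda>g s. g (\<pi> s)) ` F)"
  unfolding equi_regulated_def
proof (intro allI impI)
  fix x \<epsilon> :: real assume e: "\<epsilon> > 0"
  have "\<exists>\<delta>>0. \<forall>g\<in>F. \<forall>s s'. x < s \<and> s < x + \<delta> \<and> x < s' \<and> s' < x + \<delta> \<longrightarrow> norm (g (\<pi> s) - g (\<pi> s')) < \<epsilon>"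
  proof (cases "\<exists>\<delta>>0. J \<inter> {x<..<x+\<delta>} = {}")
    case True
    then obtain \<delta> where d: "\<delta> > 0" "J \<inter> {x<..<x+\<delta>} = {}" by blast
    have "\<pi> s = \<pi> x" if "x < s" "s < x + \<delta>" for s
      using that d by (intro floor_const) auto
    then show ?thesis using d e by (intro exI[of _ \<delta>]) auto
  next
    case False
    then have dense: "\<exists>s\<in>J. x < s \<and> s < x + \<delta>" if "\<delta> > 0" for \<delta>
      using that by fastforce
    have "x islimpt J"
      unfolding islimpt_approachable
    proof (intro allI impI)
      fix e :: real assume "e > 0"
      then show "\<exists>x'\<in>J. x' \<noteq> x \<and> dist x' x < e" using dense[of e] by (auto simp: dist_real_def)
    qed
    then have xJ: "x \<in> J" using closed closed_limpt by blast
    then have "right_dense J x" using dense right_denseI by blast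
    then obtain \<delta> where d: "\<delta> > 0"
      "\<And>g s. g \<in> F \<Longrightarrow> s \<in> J \<Longrightarrow> \<bar>s - x\<bar> < \<delta> \<Longrightarrow> norm (g s - g x) < \<epsilon> / 2"
      using equi_rd_atE[OF assms[OF xJ] half_gt_zero[OF e]] by metis
    have "norm (g (\<pi> s) - g (\<pi> s')) < \<epsilon>" if "g \<in> F" "x < s" "s < x + \<delta>" "x < s'" "s' < x + \<delta>" for g s s'
    proof -
      have r: "x \<le> \<pi> r \<and> \<pi> r \<le> r" if "x < r" for r
        using that floor_ge[OF xJ] floor_le[of r] in_bounds[OF xJ] by auto
      have "norm (g (\<pi> s) - g x) < \<epsilon> / 2" "norm (g (\<pi> s') - g x) < \<epsilon> / 2"
        using d(2)[OF that(1) floor_in] r[of s] r[of s'] that by auto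
      then show ?thesis using dist_triangle_half_l dist_norm by metis
    qed
    then show ?thesis using d(1) by blast
  qed
  then obtain d1 where d1: "d1 > 0" "\<And>g s s'. g \<in> F \<Longrightarrow>
    x < s \<Longrightarrow> s < x + d1 \<Longrightarrow> x < s' \<Longrightarrow> s' < x + d1 \<Longrightarrow> norm (g (\<pi> s) - g (\<pi> s')) < \<epsilon>"
    by blast
  have "\<exists>\<delta>>0. \<forall>g\<in>F. \<forall>s s'. x - \<delta> < s \<and> s < x \<and> x - \<delta> < s' \<and> s' < x \<longrightarrow> norm (g (\<pi> s) - g (\<pi> s')) < \<epsilon>"
  proof (cases "\<exists>\<delta>>0. J \<inter> {x-\<delta><..<x} = {}")
    case True
    then obtain \<delta> where d: "\<delta> > 0" "J \<inter> {x-\<delta><..<x} = {}" by blast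
    have "\<pi> s = \<pi> (x - \<delta>)" if "x - \<delta> < s" "s < x" for s
      using that d by (intro floor_const) auto
    then show ?thesis using d e by (intro exI[of _ \<delta>]) auto
  next
    case False
    then have dense: "\<exists>s\<in>J. x - \<delta> < s \<and> s < x" if "\<delta> > 0" for \<delta>
      using that by fastforce
    have "x islimpt J"
      unfolding islimpt_approachable
    proof (intro allI impI)
      fix e :: real assume "e > 0"
      then show "\<exists>x'\<in>J. x' \<noteq> x \<and> dist x' x < e" using dense[of e] by (auto simp: dist_real_def)
    qed
    then have xJ: "x \<in> J" using closed closed_limpt by blast
    then obtain \<delta> where d: "\<delta> > 0"
      "\<And>g s s'. g \<in> F \<Longrightarrow> s \<in> J \<Longrightarrow> s' \<in> J \<Longrightarrow> x - \<delta> < s \<Longrightarrow> s < x \<Longrightarrow> x - \<delta> < s' \<Longrightarrow> s' < x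
         \<Longrightarrow> norm (g s - g s') < \<epsilon>"
      using equi_rd_atE[OF assms[OF xJ] e] by metis
    \<comment> \<open>Floors move to the left and could fall below \<open>x - \<delta>\<close>; a
      point \<open>r\<close> of \<open>J\<close> inside the neighbourhood stops them, which is why
      the radius shrinks to \<open>x - r\<close>.\<close>
    obtain r where r: "r \<in> J" "x - \<delta> < r" "r < x" using dense[OF d(1)] by blast
    have "norm (g (\<pi> s) - g (\<pi> s')) < \<epsilon>" if "g \<in> F" "r < s" "s < x" "r < s'" "s' < x" for g s s'
    proof -
      have "r \<le> \<pi> y \<and> \<pi> y \<le> y" if "r < y" for y
        using that floor_ge[OF r(1)] floor_le[of y] in_bounds[OF r(1)] by auto
      from this[of s] this[of s'] show ?thesis
        using d(2)[OF that(1) floor_in floor_in, of s s'] r that by auto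
    qed
    then show ?thesis using r(3) by (intro exI[of _ "x - r"]) auto
  qed
  then obtain d2 where d2: "d2 > 0" "\<And>g s s'. g \<in> F \<Longrightarrow>
    x - d2 < s \<Longrightarrow> s < x \<Longrightarrow> x - d2 < s' \<Longrightarrow> s' < x \<Longrightarrow> norm (g (\<pi> s) - g (\<pi> s')) < \<epsilon>"
    by blast
  show "\<exists>\<delta>>0. \<forall>g\<in>(\<lambda>g s. g (\<pi> s)) ` F. \<forall>s s'.
     (x < s \<and> s < x + \<delta> \<and> x < s' \<and> s' < x + \<delta> \<or>
      x - \<delta> < s \<and> s < x \<and> x - \<delta> < s' \<and> s' < x) \<longrightarrow> norm (g s - g s') < \<epsilon>"
  proof (intro exI[of _ "min d1 d2"] conjI ballI allI impI)
    fix g s s' assume "g \<in> (\<lambda>g s. g (\<pi> s)) ` F" and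
      s: "x < s \<and> s < x + min d1 d2 \<and> x < s' \<and> s' < x + min d1 d2 \<or>
      x - min d1 d2 < s \<and> s < x \<and> x - min d1 d2 < s' \<and> s' < x"
    then obtain h where h: "h \<in> F" "g = (\<lambda>s. h (\<pi> s))" by auto
    show "norm (g s - g s') < \<epsilon>"
      using s d1(2)[OF h(1), of s s'] d2(2)[OF h(1), of s s'] unfolding h(2) by auto
  qed (use d1 d2 in simp)
qed

lemma equi_rd_at_comp:
  fixes \<phi> :: "real \<Rightarrow> 'x::metric_space \<Rightarrow> 'e::real_normed_vector"
  assumes t: "t \<in> J"
    and base: "equi_rd_at J ((\<lambda>y s. \<phi> s (y t)) ` Y) t"
    and equi: "uniformly_equicontinuous_on D (\<phi> ` J)"
    and range: "\<And>y s. y \<in> Y \<Longrightarrow> s \<in> J \<Longrightarrow> y s \<in> D"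
    and cont: "\<And>\<epsilon>. \<epsilon> > 0 \<Longrightarrow> \<exists>\<delta>>0. \<forall>y\<in>Y. \<forall>s\<in>J. \<bar>s - t\<bar> < \<delta> \<longrightarrow> dist (y s) (y t) < \<epsilon>"
  shows "equi_rd_at J ((\<lambda>y s. \<phi> s (y s)) ` Y) t"
  unfolding equi_rd_at_def
proof (intro allI impI)
  fix \<epsilon> :: real assume e: "\<epsilon> > 0"
  then obtain \<eta> where "\<eta> > 0" and eta: "\<And>s x x'. s \<in> J \<Longrightarrow> x \<in> D \<Longrightarrow> x' \<in> D \<Longrightarrow> dist x x' < \<eta> \<Longrightarrow>
      norm (\<phi> s x - \<phi> s x') < \<epsilon> / 3"
    using uniformly_equicontinuous_onE[OF equi, of "\<epsilon> / 3"] dist_norm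
    by (metis divide_pos_pos imageI zero_less_numeral)
  obtain d1 where d1: "d1 > 0" "\<And>y s. y \<in> Y \<Longrightarrow> s \<in> J \<Longrightarrow> \<bar>s - t\<bar> < d1 \<Longrightarrow> dist (y s) (y t) < \<eta>"
    using cont[OF \<open>\<eta> > 0\<close>] by blast
  have near: "norm (\<phi> s (y s) - \<phi> s (y t)) < \<epsilon> / 3" if "y \<in> Y" "s \<in> J" "\<bar>s - t\<bar> < d1" for y s
    using eta[OF that(2) range[OF that(1,2)] range[OF that(1) t]] d1(2)[OF that] by simp
  have "\<epsilon> / 3 > 0" using e by simp
  then obtain d2 where "d2 > 0" and
    d2R: "\<And>g s. g \<in> (\<lambda>y s. \<phi> s (y t)) ` Y \<Longrightarrow> right_dense J t \<Longrightarrow> s \<in> J \<Longrightarrow> \<bar>s - t\<bar> < d2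
      \<Longrightarrow> norm (g s - g t) < \<epsilon> / 3" and
    d2L: "\<And>g s s'. g \<in> (\<lambda>y s. \<phi> s (y t)) ` Y \<Longrightarrow> s \<in> J \<Longrightarrow> s' \<in> J \<Longrightarrow> t - d2 < s \<Longrightarrow> s < t
      \<Longrightarrow> t - d2 < s' \<Longrightarrow> s' < t \<Longrightarrow> norm (g s - g s') < \<epsilon> / 3"
    by (metis equi_rd_atE[OF base])
  note d2 = \<open>d2 > 0\<close> d2R[OF imageI] d2L[OF imageI]
  have tri: "norm (p - q) < \<epsilon>"
    if "norm (p - p') < \<epsilon> / 3" "norm (p' - q') < \<epsilon> / 3" "norm (q - q') < \<epsilon> / 3" for p p' q q' :: 'e
  proof -
    have "norm (p - q) = norm ((p - p') + (p' - q') - (q - q'))" by simp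
    also have "\<dots> \<le> norm (p - p') + norm (p' - q') + norm (q - q')"
      using norm_triangle_ineq norm_triangle_ineq4 by (smt (verit))
    finally show ?thesis using that by simp
  qed
  show "\<exists>\<delta>>0. \<forall>g\<in>(\<lambda>y s. \<phi> s (y s)) ` Y.
     (right_dense J t \<longrightarrow> (\<forall>s\<in>J. \<bar>s - t\<bar> < \<delta> \<longrightarrow> norm (g s - g t) < \<epsilon>)) \<and>
     (\<forall>s\<in>J. \<forall>s'\<in>J. t - \<delta> < s \<and> s < t \<and> t - \<delta> < s' \<and> s' < t \<longrightarrow> norm (g s - g s') < \<epsilon>)"
    unfolding ball_simps
  proof (intro exI[of _ "min d1 d2"] conjI ballI allI impI)
    fix y s assume *: "y \<in> Y" "right_dense J t" "s \<in> J" "\<bar>s - t\<bar> < min d1 d2"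
    show "norm (\<phi> s (y s) - \<phi> t (y t)) < \<epsilon>"
    proof (rule tri)
      show "norm (\<phi> s (y s) - \<phi> s (y t)) < \<epsilon> / 3" using near * by simp
      show "norm (\<phi> s (y t) - \<phi> t (y t)) < \<epsilon> / 3" using d2(2) * by simp
    qed (use e in simp)
  next
    fix y s s' assume *: "y \<in> Y" "s \<in> J" "s' \<in> J"
      "t - min d1 d2 < s \<and> s < t \<and> t - min d1 d2 < s' \<and> s' < t"
    show "norm (\<phi> s (y s) - \<phi> s' (y s')) < \<epsilon>"
    proof (rule tri)
      show "norm (\<phi> s (y s) - \<phi> s (y t)) < \<epsilon> / 3" using near[OF *(1,2)] * by auto
      show "norm (\<phi> s (y t) - \<phi> s' (y t)) < \<epsilon> / 3" using d2(3)[OF *(1-3)] * by auto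
      show "norm (\<phi> s' (y s') - \<phi> s' (y t)) < \<epsilon> / 3" using near[OF *(1,3)] * by auto
    qed
  qed (use d1 d2 in simp)
qed

end

section \<open>Regulated functions and the delta integral\<close>

lemma equi_regulated_mono: "equi_regulated G \<Longrightarrow> F \<subseteq> G \<Longrightarrow> equi_regulated F"
  unfolding equi_regulated_def by (meson subsetD)

text \<open>A regulated function is a uniform limit of step functions: the one-sided Cauchy
  conditions give them locally, and bisection glues them together.\<close>

lemma regulated_integrable:
  fixes g :: "real \<Rightarrow> 'e::banach"
  assumes "equi_regulated {g}" shows "g integrable_on {p..q}"
proof (cases "p \<le> q")
  case True
  show ?thesis
  proof (rule integrable_uniform_limit_real)
    fix e :: real assume e: "e > 0"
    from True show "\<exists>h. (\<forall>x\<in>{p..q}. norm (g x - h x) \<le> e) \<and> h integrable_on {p..q}"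
    proof (induction rule: Bolzano)
      case (trans a b c)
      then obtain h1 h2 where h: "\<forall>x\<in>{a..b}. norm (g x - h1 x) \<le> e" "h1 integrable_on {a..b}"
        "\<forall>x\<in>{b..c}. norm (g x - h2 x) \<le> e" "h2 integrable_on {b..c}" by blast
      let ?h = "\<lambda>x. if x \<le> b then h1 x else h2 x"
      have "?h integrable_on {a..b}" by (rule integrable_eq[OF h(2)]) simp
      moreover have "?h integrable_on {b..c}" by (rule integrable_spike[OF h(4), of "{b}"]) auto
      ultimately have "?h integrable_on {a..c}"
        using trans Henstock_Kurzweil_Integration.integrable_combine by blast
      then show ?case using h by (intro exI[of _ ?h]) auto
    next
      case (local x)
      obtain d where d: "d > 0" "\<And>s s'. x < s \<and> s < x + d \<and> x < s' \<and> s' < x + d \<or>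
          x - d < s \<and> s < x \<and> x - d < s' \<and> s' < x \<Longrightarrow> norm (g s - g s') < e"
        using assms e unfolding equi_regulated_def by (metis singletonI)
      \<comment> \<open>One sample value on each side of \<open>x\<close>, plus the exact value at
        \<open>x\<close>, which the one-sided conditions do not control.\<close>
      let ?h = "\<lambda>s. if s < x then g (x - d / 2) else if s = x then g x else g (x + d / 2)"
      have "\<exists>h. (\<forall>s\<in>{u..v}. norm (g s - h s) \<le> e) \<and> h integrable_on {u..v}"
        if "u \<le> x" "x \<le> v" "v - u < d" for u v
      proof (intro exI[of _ ?h] conjI ballI)
        fix s assume "s \<in> {u..v}"
        then show "norm (g s - ?h s) \<le> e"
          using d that e less_imp_le[OF d(2)[of s "x - d / 2"]] less_imp_le[OF d(2)[of s "x + d / 2"]]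
          by (auto simp: not_less)
      next
        have "?h integrable_on {u..x}"
          by (rule integrable_spike[OF integrable_const_ivl[of "g (x - d / 2)"], of "{x}"]) auto
        moreover have "?h integrable_on {x..v}"
          by (rule integrable_spike[OF integrable_const_ivl[of "g (x + d / 2)"], of "{x}"]) auto
        ultimately show "?h integrable_on {u..v}"
          using that Henstock_Kurzweil_Integration.integrable_combine by blast
      qed
      then show ?case using d(1) by blast
    qed
  qed
qed (simp add: integrable_on_empty)

text \<open>The bound is asked for in the open interval only, since the one-sided conditions say
  nothing about end points; these two points are negligible.\<close>

lemma norm_integral_minus_const:
  fixes g :: "real \<Rightarrow> 'e::banach"
  assumes "g integrable_on {p..q}" "p \<le> q" "B \<ge> 0" "\<And>s. p < s \<Longrightarrow> s < q \<Longrightarrow> norm (g s - c) \<le> B"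
  shows "norm (integral {p..q} g - (q - p) *\<^sub>R c) \<le> B * (q - p)"
proof -
  have "((\<lambda>s. g s - c) has_integral (integral {p..q} g - (q - p) *\<^sub>R c)) {p..q}"
    using has_integral_diff[OF integrable_integral[OF assms(1)] has_integral_const_real[of c p q]] assms(2)
    by simp
  then have "norm (integral {p..q} g - (q - p) *\<^sub>R c) \<le> B * measure lborel (cbox p q)"
    by (intro has_integral_bound_spike_finite[where S = "{p, q}"]) (use assms in auto)
  then show ?thesis using assms(2) by simp
qed

lemma integral_diff_ivl:
  fixes g :: "real \<Rightarrow> 'e::banach"
  assumes "\<And>p q. g integrable_on {p..q}" "a \<le> s" "s \<le> t"
  shows "integral {a..t} g - integral {a..s} g = integral {s..t} g"
  using Henstock_Kurzweil_Integration.integral_combine[OF assms(2,3) assms(1)] by (simp add: algebra_simps)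

lemma has_delta_derivative_diff:
  assumes "has_delta_derivative J U d t" "has_delta_derivative J V e t"
  shows "has_delta_derivative J (\<lambda>s. U s - V s) (d - e) t"
  unfolding has_delta_derivative_def
proof (intro allI impI)
  fix \<epsilon> :: real assume "\<epsilon> > 0"
  then have "\<epsilon> / 2 > 0" by simp
  obtain d1 where d1: "d1 > 0" "\<forall>s \<in> ts_ball J d1 t.
      norm (U (ts_sigma J t) - U s - (ts_sigma J t - s) *\<^sub>R d) \<le> \<epsilon> / 2 * \<bar>ts_sigma J t - s\<bar>"
    using assms(1) \<open>\<epsilon> / 2 > 0\<close> unfolding has_delta_derivative_def by blast
  obtain d2 where d2: "d2 > 0" "\<forall>s \<in> ts_ball J d2 t.
      norm (V (ts_sigma J t) - V s - (ts_sigma J t - s) *\<^sub>R e) \<le> \<epsilon> / 2 * \<bar>ts_sigma J t - s\<bar>"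
    using assms(2) \<open>\<epsilon> / 2 > 0\<close> unfolding has_delta_derivative_def by blast
  show "\<exists>\<delta>>0. \<forall>s\<in>ts_ball J \<delta> t. norm (U (ts_sigma J t) - V (ts_sigma J t) - (U s - V s) -
      (ts_sigma J t - s) *\<^sub>R (d - e)) \<le> \<epsilon> * \<bar>ts_sigma J t - s\<bar>"
  proof (intro exI[of _ "min d1 d2"] conjI ballI)
    fix s assume s: "s \<in> ts_ball J (min d1 d2) t"
    let ?A = "U (ts_sigma J t) - U s - (ts_sigma J t - s) *\<^sub>R d"
    let ?B = "V (ts_sigma J t) - V s - (ts_sigma J t - s) *\<^sub>R e"
    have "s \<in> ts_ball J d1 t" "s \<in> ts_ball J d2 t" using s by (auto simp: ts_ball_def)
    then have "norm ?A \<le> \<epsilon> / 2 * \<bar>ts_sigma J t - s\<bar>" "norm ?B \<le> \<epsilon> / 2 * \<bar>ts_sigma J t - s\<bar>"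
      using d1 d2 by auto
    then have "norm (?A - ?B) \<le> \<epsilon> * \<bar>ts_sigma J t - s\<bar>"
      using norm_triangle_ineq4[of ?A ?B] by simp
    then show "norm (U (ts_sigma J t) - V (ts_sigma J t) - (U s - V s) -
      (ts_sigma J t - s) *\<^sub>R (d - e)) \<le> \<epsilon> * \<bar>ts_sigma J t - s\<bar>"
      by (simp add: algebra_simps)
  qed (use d1 d2 in simp)
qed

section \<open>Fundamental theorem for the delta integral\<close>

context compact_time_scale
begin

lemma floor_integrable:
  fixes g :: "real \<Rightarrow> 'e::banach"
  assumes "\<And>t. t \<in> J \<Longrightarrow> equi_rd_at J {g} t"
  shows "(\<lambda>s. g (\<pi> s)) integrable_on {p..q}"
  using equi_regulated_floor[OF assms] by (intro regulated_integrable) simp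

text \<open>Across a gap the floor is constantly \<open>t\<close>, so the integral grows by exactly
  \<open>(ts_sigma J t - t) *\<^sub>R g t\<close>. At a right-dense point the floor of anything
  between \<open>s\<close> and \<open>t\<close> is close to \<open>t\<close>, where \<open>g\<close>
  is close to \<open>g t\<close>. At a right-scattered point the only error comes from the piece
  left of \<open>t\<close>, and its length tends to 0.\<close>

lemma floor_integral_has_delta_derivative:
  fixes g :: "real \<Rightarrow> 'e::banach"
  assumes g: "\<And>t. t \<in> J \<Longrightarrow> equi_rd_at J {g} t" and t: "t \<in> J"
  shows "has_delta_derivative J (\<lambda>t. integral {a..t} (\<lambda>s. g (\<pi> s))) (g t) t"
proof -
  let ?g = "\<lambda>s. g (\<pi> s)"
  let ?U = "\<lambda>t. integral {a..t} ?g"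
  let ?\<sigma> = "ts_sigma J t"
  have int: "?g integrable_on {p..q}" for p q using g by (rule floor_integrable)
  note diff = integral_diff_ivl[of ?g, OF int]
  note at = in_bounds(1)[OF t]
  have "\<exists>\<delta>>0. \<forall>s \<in> ts_ball J \<delta> t. norm (?U ?\<sigma> - ?U s - (?\<sigma> - s) *\<^sub>R g t) \<le> \<epsilon> * \<bar>?\<sigma> - s\<bar>"
    if e: "\<epsilon> > 0" for \<epsilon>
  proof (cases "right_dense J t")
    case True
    then have sig: "?\<sigma> = t" by (simp add: right_dense_def)
    obtain \<delta> where d: "\<delta> > 0" "\<And>s. s \<in> J \<Longrightarrow> \<bar>s - t\<bar> < \<delta> \<Longrightarrow> norm (g s - g t) < \<epsilon>"
      using equi_rd_atE[OF g[OF t] e] True by (metis singletonI)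
    show ?thesis unfolding sig
    proof (intro exI[of _ \<delta>] conjI ballI)
      fix s assume "s \<in> ts_ball J \<delta> t"
      then have s: "s \<in> J" "\<bar>s - t\<bar> < \<delta>" "a \<le> s" using in_bounds by (auto simp: ts_ball_def)
      show "norm (?U t - ?U s - (t - s) *\<^sub>R g t) \<le> \<epsilon> * \<bar>t - s\<bar>"
      proof (cases "s \<le> t")
        case True
        have "norm (integral {s..t} ?g - (t - s) *\<^sub>R g t) \<le> \<epsilon> * (t - s)"
        proof (rule norm_integral_minus_const[OF int True])
          fix r assume "s < r" "r < t"
          then have "\<bar>\<pi> r - t\<bar> < \<delta>" using floor_ge[OF s(1), of r] floor_le[of r] s by auto
          then show "norm (?g r - g t) \<le> \<epsilon>" using d(2)[OF floor_in] by (simp add: less_imp_le)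
        qed (use e in auto)
        then show ?thesis using diff[OF s(3) True] True by simp
      next
        case False
        then have ts: "t \<le> s" by simp
        have "norm (integral {t..s} ?g - (s - t) *\<^sub>R g t) \<le> \<epsilon> * (s - t)"
        proof (rule norm_integral_minus_const[OF int ts])
          fix r assume "t < r" "r < s"
          then have "\<bar>\<pi> r - t\<bar> < \<delta>" using floor_ge[OF t, of r] floor_le[of r] s at by auto
          then show "norm (?g r - g t) \<le> \<epsilon>" using d(2)[OF floor_in] by (simp add: less_imp_le)
        qed (use e in simp)
        moreover have "?U t - ?U s - (t - s) *\<^sub>R g t = - (integral {t..s} ?g - (s - t) *\<^sub>R g t)"
          using diff[OF at ts] by (simp add: algebra_simps)
        ultimately show ?thesis using ts by (simp only: norm_minus_cancel) simp
      qed
    qed (use d in simp)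
  next
    case False
    then have sig: "t < ?\<sigma>" using sigma_ge[OF t] by (simp add: right_dense_def)
    obtain \<delta> where d: "\<delta> > 0" "\<And>s s'. s \<in> J \<Longrightarrow> s' \<in> J \<Longrightarrow> t - \<delta> < s \<Longrightarrow> s < t \<Longrightarrow> t - \<delta> < s' \<Longrightarrow>
        s' < t \<Longrightarrow> norm (g s - g s') < 1"
      using equi_rd_atE[OF g[OF t] zero_less_one] by (metis singletonI)
    \<comment> \<open>A right-scattered point carries no continuity condition, so \<open>g\<close>
      is merely bounded to its left, by the one-sided Cauchy condition with tolerance 1.\<close>
    obtain B where B: "B \<ge> 0" "\<And>r. r \<in> J \<Longrightarrow> t - \<delta> < r \<Longrightarrow> r < t \<Longrightarrow> norm (g r - g t) \<le> B"
    proof (cases "\<exists>s\<in>J. t - \<delta> < s \<and> s < t")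
      case True
      then obtain s where s: "s \<in> J" "t - \<delta> < s" "s < t" by blast
      show ?thesis
      proof (rule that[of "1 + norm (g s - g t)"])
        fix r assume "r \<in> J" "t - \<delta> < r" "r < t"
        then have "norm (g r - g s) < 1" using d(2) s by blast
        then show "norm (g r - g t) \<le> 1 + norm (g s - g t)"
          using norm_triangle_ineq[of "g r - g s" "g s - g t"] by simp
      qed simp
    next
      case False
      then show ?thesis using that[of 0] by blast
    qed
    \<comment> \<open>The bound \<open>?\<sigma> - t\<close> forces \<open>s \<le> t\<close>. The
      last bound keeps \<open>B * (t - s)\<close> below \<open>\<epsilon> * (?\<sigma> - t)\<close>,
      which does not shrink as \<open>s\<close> approaches \<open>t\<close>; \<open>B + 1\<close>
      because \<open>B\<close> may be 0.\<close>
    define \<eta> where "\<eta> = min \<delta> (min (?\<sigma> - t) (\<epsilon> * (?\<sigma> - t) / (B + 1)))"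
    show ?thesis
    proof (intro exI[of _ \<eta>] conjI ballI)
      show "\<eta> > 0" using d(1) sig e B(1) by (simp add: \<eta>_def)
      fix s assume "s \<in> ts_ball J \<eta> t"
      then have s: "s \<in> J" "\<bar>s - t\<bar> < \<eta>" "a \<le> s" using in_bounds by (auto simp: ts_ball_def)
      have st: "s \<le> t" using sigma_le[OF s(1), of t] s(2) by (fastforce simp: \<eta>_def)
      have 1: "norm (integral {s..t} ?g - (t - s) *\<^sub>R g t) \<le> B * (t - s)"
      proof (rule norm_integral_minus_const[OF int st B(1)])
        fix r assume "s < r" "r < t"
        then have "t - \<delta> < \<pi> r" "\<pi> r < t"
          using floor_ge[OF s(1), of r] floor_le[of r] s by (auto simp: \<eta>_def)
        then show "norm (?g r - g t) \<le> B" using B(2)[OF floor_in] by blast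
      qed
      have 2: "norm (integral {t..?\<sigma>} ?g - (?\<sigma> - t) *\<^sub>R g t) \<le> 0 * (?\<sigma> - t)"
        by (rule norm_integral_minus_const[OF int less_imp_le[OF sig]]) (use floor_left[OF t] in auto)
      have eq: "?U ?\<sigma> - ?U s - (?\<sigma> - s) *\<^sub>R g t = (integral {s..t} ?g - (t - s) *\<^sub>R g t)
            + (integral {t..?\<sigma>} ?g - (?\<sigma> - t) *\<^sub>R g t)"
        using diff[OF s(3) st] diff[OF at less_imp_le[OF sig]] by (simp add: algebra_simps)
      have "t - s \<le> \<epsilon> * (?\<sigma> - t) / (B + 1)" using s(2) st by (simp add: \<eta>_def)
      then have "(B + 1) * (t - s) \<le> \<epsilon> * (?\<sigma> - t)" using B(1) by (simp add: field_simps)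
      moreover have "B * (t - s) \<le> (B + 1) * (t - s)" using st by (simp add: mult_right_mono)
      moreover have "\<epsilon> * (?\<sigma> - t) \<le> \<epsilon> * \<bar>?\<sigma> - s\<bar>" using e st sig by simp
      moreover have "norm (?U ?\<sigma> - ?U s - (?\<sigma> - s) *\<^sub>R g t) \<le> B * (t - s)"
        unfolding eq using 1 2 norm_triangle_ineq[of "integral {s..t} ?g - (t - s) *\<^sub>R g t"
          "integral {t..?\<sigma>} ?g - (?\<sigma> - t) *\<^sub>R g t"] by simp
      ultimately show "norm (?U ?\<sigma> - ?U s - (?\<sigma> - s) *\<^sub>R g t) \<le> \<epsilon> * \<bar>?\<sigma> - s\<bar>" by linarith
    qed
  qed
  then show ?thesis unfolding has_delta_derivative_def by blast
qed

lemma zero_delta_derivative_continuous: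
  fixes D :: "real \<Rightarrow> 'e::real_normed_vector"
  assumes "has_delta_derivative J D 0 c" "c \<in> J" "\<eta> > 0"
  shows "\<exists>\<delta>>0. \<forall>s\<in>J. \<bar>s - c\<bar> < \<delta> \<longrightarrow> norm (D s - D c) \<le> \<eta>"
proof -
  let ?\<sigma> = "ts_sigma J c"
  \<comment> \<open>Both \<open>D s\<close> and \<open>D c\<close> are compared with
    \<open>D ?\<sigma>\<close>; for \<open>\<bar>s - c\<bar> < 1\<close> the two distances to
    \<open>?\<sigma>\<close> add up to at most \<open>2 * (?\<sigma> - c) + 1\<close>.\<close>
  let ?e = "\<eta> / (2 * (?\<sigma> - c) + 1)"
  have ge: "c \<le> ?\<sigma>" using sigma_ge assms(2) .
  have "?e > 0" using assms(3) ge by (intro divide_pos_pos) auto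
  then obtain \<delta> where d: "\<delta> > 0" "\<forall>s\<in>ts_ball J \<delta> c. norm (D ?\<sigma> - D s - (?\<sigma> - s) *\<^sub>R 0) \<le> ?e * \<bar>?\<sigma> - s\<bar>"
    using assms(1) unfolding has_delta_derivative_def by blast
  show ?thesis
  proof (intro exI[of _ "min \<delta> 1"] conjI ballI impI)
    fix s assume s: "s \<in> J" "\<bar>s - c\<bar> < min \<delta> 1"
    have "s \<in> ts_ball J \<delta> c" "c \<in> ts_ball J \<delta> c" using d(1) s assms(2) by (auto simp: ts_ball_def)
    then have "norm (D ?\<sigma> - D s) \<le> ?e * \<bar>?\<sigma> - s\<bar>" "norm (D ?\<sigma> - D c) \<le> ?e * \<bar>?\<sigma> - c\<bar>"
      using d(2) by auto
    moreover have "norm (D s - D c) \<le> norm (D ?\<sigma> - D s) + norm (D ?\<sigma> - D c)"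
      using norm_triangle_ineq4[of "D ?\<sigma> - D c" "D ?\<sigma> - D s"] by simp
    ultimately have "norm (D s - D c) \<le> ?e * (\<bar>?\<sigma> - s\<bar> + \<bar>?\<sigma> - c\<bar>)"
      by (simp add: ring_distribs)
    also have "\<dots> \<le> ?e * (2 * (?\<sigma> - c) + 1)"
      using \<open>?e > 0\<close> s ge by (intro mult_left_mono) auto
    also have "\<dots> = \<eta>" using ge by simp
    finally show "norm (D s - D c) \<le> \<eta>" .
  qed (use d in simp)
qed

text \<open>Continuous induction on the mean value estimate with slope \<epsilon>. The set of points
  up to which it holds contains its supremum \<open>c\<close>, by continuity from the left. If
  \<open>c < b\<close>, the derivative at \<open>c\<close> carries the estimate further, to a nearby
  point when \<open>c\<close> is right-dense and to its jump otherwise.\<close>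

lemma zero_delta_derivative_const:
  fixes D :: "real \<Rightarrow> 'e::real_normed_vector"
  assumes D: "\<And>t. t \<in> ts_kappa J \<Longrightarrow> has_delta_derivative J D 0 t" and t: "t \<in> J"
  shows "D t = D a"
proof -
  have S: "\<forall>t\<in>J. norm (D t - D a) \<le> \<epsilon> * (t - a)" if e: "\<epsilon> > 0" for \<epsilon>
  proof -
    let ?S = "\<lambda>s. norm (D s - D a) \<le> \<epsilon> * (s - a)"
    let ?A = "{t \<in> J. \<forall>s\<in>J. s \<le> t \<longrightarrow> ?S s}"
    define c where "c = Sup ?A"
    have aA: "a \<in> ?A" using a_in in_bounds by force
    have up: "s \<le> c" if "s \<in> ?A" for s unfolding c_def by (intro cSup_upper bdd that) auto
    have cJ: "c \<in> J" unfolding c_def using aA by (intro closed_subset_contains_Sup[OF closed] bdd) auto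
    have below: "\<exists>s\<in>?A. x < s" if "x < c" for x
      using less_cSupD[of ?A x] aA that unfolding c_def by blast
    have cA: "c \<in> ?A"
    proof (rule ccontr)
      assume n: "c \<notin> ?A"
      have l: "\<exists>s\<in>?A. x < s \<and> s < c" if "x < c" for x
      proof -
        obtain s where s: "s \<in> ?A" "x < s" using below[OF \<open>x < c\<close>] by blast
        then have "s \<noteq> c" using n by blast
        then have "s < c" using up[OF s(1)] by simp
        then show ?thesis using s by blast
      qed
      \<comment> \<open>This matters when \<open>c = b\<close>: the derivative is given there only
        if \<open>b\<close> is not a left-scattered maximum.\<close>
      have "left_dense J c"
      proof (rule ccontr)
        assume "\<not> left_dense J c"
        then obtain \<delta> where "\<delta> > 0" "J \<inter> {c - \<delta><..<c} = {}" using not_left_dense_gap cJ by blast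
        then show False using l[of "c - \<delta>"] by auto
      qed
      then have der: "has_delta_derivative J D 0 c" using D in_kappa cJ by blast
      have "?S c"
      proof (rule field_le_epsilon)
        fix \<eta> :: real assume "\<eta> > 0"
        then obtain \<delta> where d: "\<delta> > 0" "\<forall>s\<in>J. \<bar>s - c\<bar> < \<delta> \<longrightarrow> norm (D s - D c) \<le> \<eta>"
          using zero_delta_derivative_continuous[OF der cJ] by blast
        obtain s where s: "s \<in> ?A" "c - \<delta> < s" "s < c" using l[of "c - \<delta>"] d by auto
        then have "norm (D s - D c) \<le> \<eta>" "norm (D s - D a) \<le> \<epsilon> * (s - a)" using d by auto
        moreover have "norm (D c - D a) \<le> norm (D s - D a) + norm (D s - D c)"
          using norm_triangle_ineq4[of "D s - D a" "D s - D c"] by simp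
        moreover have "\<epsilon> * (s - a) \<le> \<epsilon> * (c - a)" using e s by simp
        ultimately show "norm (D c - D a) \<le> \<epsilon> * (c - a) + \<eta>" by linarith
      qed
      moreover have "?S s" if "s \<in> J" "s < c" for s using below[OF that(2)] that(1) by auto
      ultimately have "c \<in> ?A" using cJ by (auto simp: order_le_less)
      then show False using n by simp
    qed
    have "c = b"
    proof (rule ccontr)
      assume "c \<noteq> b"
      then have cb: "c < b" using in_bounds cJ by force
      then have "has_delta_derivative J D 0 c" using D in_kappa cJ by blast
      then obtain \<delta> where d: "\<delta> > 0" "\<forall>s\<in>ts_ball J \<delta> c.
          norm (D (ts_sigma J c) - D s - (ts_sigma J c - s) *\<^sub>R 0) \<le> \<epsilon> * \<bar>ts_sigma J c - s\<bar>"
        unfolding has_delta_derivative_def using e by blast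
      have step: "?S s" if "norm (D s - D c) \<le> \<epsilon> * (s - c)" for s
      proof -
        have "norm (D s - D a) \<le> norm (D s - D c) + norm (D c - D a)"
          using norm_triangle_ineq[of "D s - D c" "D c - D a"] by simp
        moreover have "norm (D c - D a) \<le> \<epsilon> * (c - a)" using cA by auto
        ultimately have "norm (D s - D a) \<le> \<epsilon> * (s - c) + \<epsilon> * (c - a)" using that by linarith
        then show ?thesis by (simp add: algebra_simps)
      qed
      show False
      proof (cases "right_dense J c")
        case True
        then have sig: "ts_sigma J c = c" by (simp add: right_dense_def)
        obtain s where s: "s \<in> J" "c < s" "s < c + \<delta>"
          using right_dense_approx[OF True cJ cb d(1)] by blast
        have "?S r" if "r \<in> J" "c < r" "r \<le> s" for r
        proof (rule step)
          have "r \<in> ts_ball J \<delta> c" using d(1) s that by (auto simp: ts_ball_def)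
          then have "norm (D c - D r) \<le> \<epsilon> * \<bar>c - r\<bar>" using d(2) by (simp add: sig)
          then show "norm (D r - D c) \<le> \<epsilon> * (r - c)" using that by (simp add: norm_minus_commute)
        qed
        moreover have "?S r" if "r \<in> J" "r \<le> c" for r using cA that by auto
        ultimately have "s \<in> ?A" using s(1) by (force simp: not_le)
        then show False using up s(2) by force
      next
        case False
        let ?\<sigma> = "ts_sigma J c"
        have sig: "c < ?\<sigma>" using False sigma_ge[OF cJ] by (simp add: right_dense_def)
        have "c \<in> ts_ball J \<delta> c" using d(1) cJ by (simp add: ts_ball_def)
        then have "norm (D ?\<sigma> - D c) \<le> \<epsilon> * (?\<sigma> - c)" using d(2) sig by auto
        then have "?S ?\<sigma>" by (rule step)
        moreover have "?S r" if "r \<in> J" "r \<le> c" for r using cA that by auto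
        moreover have "r = ?\<sigma>" if "r \<in> J" "c < r" "r \<le> ?\<sigma>" for r using sigma_le that by force
        ultimately have "?\<sigma> \<in> ?A" using sigma_in[OF cJ] by (force simp: not_le)
        then show False using up sig by force
      qed
    qed
    then show ?thesis using cA in_bounds by auto
  qed
  have "norm (D t - D a) \<le> 0"
  proof (rule field_le_epsilon)
    fix \<eta> :: real assume "\<eta> > 0"
    have p: "t - a + 1 > 0" using in_bounds[OF t] by simp
    then have "norm (D t - D a) \<le> \<eta> / (t - a + 1) * (t - a)"
      using S[of "\<eta> / (t - a + 1)"] \<open>\<eta> > 0\<close> t by simp
    also have "\<dots> \<le> \<eta>" using p \<open>\<eta> > 0\<close> by (simp add: field_simps)
    finally show "norm (D t - D a) \<le> 0 + \<eta>" by simp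
  qed
  then show ?thesis by simp
qed

text \<open>The definite description needs all antiderivatives to differ by constants. Their
  derivatives are prescribed on \<open>ts_kappa J\<close> only, but this still determines the value
  at a left-scattered maximum, through the jump from its predecessor.\<close>

lemma delta_integral_eq:
  fixes g :: "real \<Rightarrow> 'e::banach"
  assumes g: "\<And>t. t \<in> J \<Longrightarrow> equi_rd_at J {g} t" and t: "t \<in> J"
  shows "delta_integral J a t g = integral {a..t} (\<lambda>s. g (\<pi> s))"
  unfolding delta_integral_def
proof (rule the_equality)
  let ?U = "\<lambda>t. integral {a..t} (\<lambda>s. g (\<pi> s))"
  have U: "delta_antiderivative J g ?U"
    unfolding delta_antiderivative_def
    using floor_integral_has_delta_derivative[OF g] by (auto simp: ts_kappa_def)
  then show "\<exists>U. delta_antiderivative J g U \<and> ?U t = U t - U a" by (intro exI[of _ ?U]) simp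
  fix I assume "\<exists>U. delta_antiderivative J g U \<and> I = U t - U a"
  then obtain V where V: "delta_antiderivative J g V" "I = V t - V a" by blast
  have "has_delta_derivative J (\<lambda>s. V s - ?U s) 0 s" if "s \<in> ts_kappa J" for s
    using has_delta_derivative_diff[of J V "g s" s ?U "g s"] U V(1) that
    unfolding delta_antiderivative_def by simp
  from zero_delta_derivative_const[OF this t] show "I = ?U t" using V(2) by (simp add: algebra_simps)
qed

end

section \<open>Sublinear measures of noncompactness\<close>

locale sublinear_measure =
  fixes \<mu> :: "'e::banach set \<Rightarrow> real"
  assumes sublinear: "sublinear_mnc \<mu>"
begin

lemma mnc: "measure_of_noncompactness \<mu>"
  using sublinear by (simp add: sublinear_mnc_def)

lemma nonneg: "X \<noteq> {} \<Longrightarrow> bounded X \<Longrightarrow> \<mu> X \<ge> 0"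
  using mnc by (auto simp: measure_of_noncompactness_def nonempty_bounded_def)

lemma mono: "X \<noteq> {} \<Longrightarrow> X \<subseteq> Y \<Longrightarrow> bounded Y \<Longrightarrow> \<mu> X \<le> \<mu> Y"
  using mnc[unfolded measure_of_noncompactness_def, THEN conjunct2, THEN conjunct2, THEN conjunct2,
      THEN conjunct1, rule_format, of X Y] bounded_subset[of Y X]
  by (auto simp: nonempty_bounded_def)

lemma scale:
  assumes "I \<noteq> {}" "bounded (x ` I)" shows "\<mu> ((\<lambda>n. c *\<^sub>R x n) ` I) = \<bar>c\<bar> * \<mu> (x ` I)"
proof -
  have "\<mu> ((\<lambda>v. c *\<^sub>R v) ` x ` I) = \<bar>c\<bar> * \<mu> (x ` I)"
    using sublinear assms by (simp add: sublinear_mnc_def nonempty_bounded_def)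
  then show ?thesis by (simp add: image_image)
qed

text \<open>Termwise sums of two indexed families fill only part of the Minkowski sum; the set
  \<open>Z\<close> stands for such a part, and monotonicity takes care of the rest.\<close>

lemma add_sets:
  assumes "X \<noteq> {}" "bounded X" "Y \<noteq> {}" "bounded Y" "Z \<noteq> {}" "Z \<subseteq> {x + y |x y. x \<in> X \<and> y \<in> Y}"
  shows "\<mu> Z \<le> \<mu> X + \<mu> Y"
proof -
  have "{x + y |x y. x \<in> X \<and> y \<in> Y} = (\<Union>x\<in>X. \<Union>y\<in>Y. {x + y})" by auto
  then have "bounded {x + y |x y. x \<in> X \<and> y \<in> Y}" using bounded_sums[OF assms(2,4)] by simp
  then have "\<mu> Z \<le> \<mu> {x + y |x y. x \<in> X \<and> y \<in> Y}" using mono assms by blast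
  also have "\<dots> \<le> \<mu> X + \<mu> Y"
    using sublinear assms by (simp add: sublinear_mnc_def nonempty_bounded_def)
  finally show ?thesis .
qed

lemma add:
  assumes "I \<noteq> {}" "bounded (x ` I)" "bounded (y ` I)"
  shows "\<mu> ((\<lambda>n. x n + y n) ` I) \<le> \<mu> (x ` I) + \<mu> (y ` I)"
  by (rule add_sets) (use assms in auto)

text \<open>The Lipschitz constant of \<mu> for the Hausdorff distance. It may be 0, hence the
  \<open>+ 1\<close> in later denominators.\<close>

definition ball_measure :: real where "ball_measure = \<mu> (cball 0 1)"

lemma ball_measure_nonneg: "ball_measure \<ge> 0"
  unfolding ball_measure_def by (intro nonneg) auto

text \<open>No maximum property of \<open>\<mu>\<close> is available, so small perturbations are absorbed by the measure of
  a small ball.\<close>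

lemma near:
  assumes "I \<noteq> {}" "bounded (y ` I)" "r \<ge> 0" "\<And>n. n \<in> I \<Longrightarrow> norm (x n - y n) \<le> r"
  shows "\<mu> (x ` I) \<le> \<mu> (y ` I) + r * ball_measure"
proof -
  let ?B = "(\<lambda>z. r *\<^sub>R z) ` cball (0::'e) 1"
  have "bounded ?B" by (intro bounded_scaling bounded_cball)
  have "\<mu> (x ` I) \<le> \<mu> (y ` I) + \<mu> ?B"
  proof (rule add_sets)
    show "x ` I \<subseteq> {p + q |p q. p \<in> y ` I \<and> q \<in> ?B}"
    proof
      fix v assume "v \<in> x ` I"
      then obtain n where n: "n \<in> I" "v = x n" by blast
      have "x n - y n = r *\<^sub>R ((1 / r) *\<^sub>R (x n - y n))"
        using assms(3) assms(4)[OF n(1)] by (cases "r = 0") auto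
      moreover have "norm ((1 / r) *\<^sub>R (x n - y n)) \<le> 1"
        using assms(3) assms(4)[OF n(1)] unfolding norm_scaleR by (cases "r = 0") simp_all
      then have "(1 / r) *\<^sub>R (x n - y n) \<in> cball 0 1" by (simp only: mem_cball_0)
      ultimately have "x n - y n \<in> ?B" by (rule image_eqI)
      then show "v \<in> {p + q |p q. p \<in> y ` I \<and> q \<in> ?B}"
        using n by (intro CollectI exI[of _ "y n"] exI[of _ "x n - y n"]) auto
    qed
  qed (use assms \<open>bounded ?B\<close> in auto)
  also have "\<mu> ?B = r * ball_measure"
    using scale[of "cball 0 1" "\<lambda>z. z" r] assms(3) by (simp add: ball_measure_def)
  finally show ?thesis .
qed

text \<open>For every interior \<open>s\<close> the integrals lie within
  \<open>\<epsilon> * (q - p)\<close> of \<open>(q - p) *\<^sub>R g n s\<close>, so homogeneity of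
  \<mu> turns the measure of the integrals into the constant lower bound \<open>?C\<close> for
  \<open>h s\<close>. Integrating this bound over \<open>s\<close> yields the claim.\<close>

lemma integral_small_oscillation:
  fixes g :: "'i \<Rightarrow> real \<Rightarrow> 'e" and h :: "real \<Rightarrow> real"
  assumes I: "I \<noteq> {}" and int: "\<And>n p q. n \<in> I \<Longrightarrow> g n integrable_on {p..q}"
    and bd: "\<And>s. bounded ((\<lambda>n. g n s) ` I)"
    and h: "\<And>p q. h integrable_on {p..q}" "\<And>s. \<mu> ((\<lambda>n. g n s) ` I) \<le> h s"
    and pq: "p \<le> q" and e: "\<epsilon> \<ge> 0"
    and osc: "\<And>n s s'. n \<in> I \<Longrightarrow> p < s \<Longrightarrow> s < q \<Longrightarrow> p < s' \<Longrightarrow> s' < q \<Longrightarrow> norm (g n s - g n s') \<le> \<epsilon>"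
  shows "\<mu> ((\<lambda>n. integral {p..q} (g n)) ` I) \<le> integral {p..q} h + \<epsilon> * ball_measure * (q - p)"
proof (cases "p = q")
  case True
  \<comment> \<open>Integrals over a point vanish, and homogeneity with factor 0 shows that the zero
    set has measure 0.\<close>
  have "\<mu> ((\<lambda>n. 0 *\<^sub>R g n p) ` I) = 0" using scale[OF I bd, of 0] by simp
  then show ?thesis using True by simp
next
  case False
  let ?X = "\<mu> ((\<lambda>n. integral {p..q} (g n)) ` I)"
  have pos: "q - p > 0" using False pq by simp
  let ?C = "?X / (q - p) - \<epsilon> * ball_measure"
  have "?C \<le> h s" if s: "p < s" "s < q" for s
  proof -
    have "?X \<le> \<mu> ((\<lambda>n. (q - p) *\<^sub>R g n s) ` I) + \<epsilon> * (q - p) * ball_measure"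
    proof (rule near[OF I])
      have "bounded ((\<lambda>v. (q - p) *\<^sub>R v) ` (\<lambda>n. g n s) ` I)" by (intro bounded_scaling bd)
      then show "bounded ((\<lambda>n. (q - p) *\<^sub>R g n s) ` I)" by (simp add: image_image)
      show "norm (integral {p..q} (g n) - (q - p) *\<^sub>R g n s) \<le> \<epsilon> * (q - p)" if "n \<in> I" for n
        by (rule norm_integral_minus_const[OF int[OF that] pq e]) (use osc that s in blast)
    qed (use e pos in simp)
    also have "\<mu> ((\<lambda>n. (q - p) *\<^sub>R g n s) ` I) = (q - p) * \<mu> ((\<lambda>n. g n s) ` I)"
      using scale[OF I bd] pos by simp
    also have "\<dots> \<le> (q - p) * h s" using h(2) pos by simp
    finally have "?X \<le> (q - p) * (h s + \<epsilon> * ball_measure)" by (simp add: algebra_simps)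
    then show ?thesis using pos by (simp add: pos_divide_le_eq mult.commute algebra_simps)
  qed
  have "((\<lambda>s. ?C) has_integral ((q - p) * ?C)) {p..q}"
    using has_integral_const_real[of ?C p q] pq by simp
  \<comment> \<open>At the end points no oscillation bound is assumed, so \<open>?C\<close> need not
    lie below \<open>h\<close>; \<open>h\<close> itself is put there.\<close>
  then have 1: "((\<lambda>s. if s = p \<or> s = q then h s else ?C) has_integral ((q - p) * ?C)) {p..q}"
    by (rule has_integral_spike_finite[of "{p, q}", rotated 2]) auto
  have "(q - p) * ?C \<le> integral {p..q} h"
    by (rule has_integral_le[OF 1 integrable_integral[OF h(1)]])
      (use \<open>\<And>s. p < s \<Longrightarrow> s < q \<Longrightarrow> ?C \<le> h s\<close> in auto)
  moreover have "(q - p) * ?C = ?X - \<epsilon> * ball_measure * (q - p)"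
    using pos by (simp add: field_simps)
  ultimately show ?thesis by linarith
qed

lemma bounded_integrals:
  fixes g :: "'i \<Rightarrow> real \<Rightarrow> 'e"
  assumes "\<And>n p q. n \<in> I \<Longrightarrow> g n integrable_on {p..q}" "\<And>n s. n \<in> I \<Longrightarrow> norm (g n s) \<le> B" "B \<ge> 0"
  shows "bounded ((\<lambda>n. integral {p..q} (g n)) ` I)"
proof (cases "p \<le> q")
  case True
  show ?thesis
    by (rule boundedI[of _ "B * (q - p)"])
      (use norm_integral_minus_const[OF assms(1) True assms(3), where c = 0] assms(2) in auto)
next
  case False
  then show ?thesis by (intro boundedI[of _ 0]) auto
qed

text \<open>The error \<open>\<eta> * (q - p)\<close> is additive over adjacent intervals, so by
  subadditivity of \<mu> the estimate only has to be checked on short intervals, where the common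
  one-sided oscillation is small. The integrable majorant \<open>h\<close> avoids any question of
  whether the measure of the values is integrable in \<open>s\<close>.\<close>

lemma integral_le:
  fixes g :: "'i \<Rightarrow> real \<Rightarrow> 'e" and h :: "real \<Rightarrow> real"
  assumes I: "I \<noteq> {}" and reg: "equi_regulated (g ` I)"
    and bd: "\<And>n s. n \<in> I \<Longrightarrow> norm (g n s) \<le> B"
    and h: "\<And>p q. h integrable_on {p..q}" "\<And>s. \<mu> ((\<lambda>n. g n s) ` I) \<le> h s"
    and pq: "p \<le> q"
  shows "\<mu> ((\<lambda>n. integral {p..q} (g n)) ` I) \<le> integral {p..q} h"
proof -
  have "B \<ge> 0" using I bd by (metis all_not_in_conv norm_ge_zero order_trans)
  have int: "g n integrable_on {p..q}" if "n \<in> I" for n p q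
    using that by (intro regulated_integrable equi_regulated_mono[OF reg]) auto
  have bd': "bounded ((\<lambda>n. g n s) ` I)" for s using bd by (intro boundedI[of _ B]) auto
  note bi = bounded_integrals[OF int bd \<open>B \<ge> 0\<close>]
  let ?X = "\<lambda>p q. \<mu> ((\<lambda>n. integral {p..q} (g n)) ` I)"
  have split: "?X u w \<le> integral {u..w} h + \<eta> * (w - u)"
    if "?X u v \<le> integral {u..v} h + \<eta> * (v - u)" "?X v w \<le> integral {v..w} h + \<eta> * (w - v)"
      "u \<le> v" "v \<le> w" for u v w \<eta>
  proof -
    have "(\<lambda>n. integral {u..w} (g n)) ` I = (\<lambda>n. integral {u..v} (g n) + integral {v..w} (g n)) ` I"
      using Henstock_Kurzweil_Integration.integral_combine[OF that(3,4) int] by (intro image_cong) auto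
    then have "?X u w \<le> ?X u v + ?X v w" using add[OF I bi bi] by simp
    also have "\<dots> \<le> integral {u..v} h + integral {v..w} h + \<eta> * (w - u)"
      using that(1,2) by (simp add: algebra_simps)
    finally show ?thesis
      using Henstock_Kurzweil_Integration.integral_combine[OF that(3,4) h(1)] by simp
  qed
  have main: "?X p q \<le> integral {p..q} h + \<eta> * (q - p)" if "\<eta> > 0" for \<eta>
    using pq
  proof (induction rule: Bolzano)
    case (trans u v w)
    then show ?case by (intro split[of u v _ w])
  next
    case (local x)
    define \<epsilon> where "\<epsilon> = \<eta> / (ball_measure + 1)"
    have e: "\<epsilon> > 0" "\<epsilon> * ball_measure \<le> \<eta>"
      using \<open>\<eta> > 0\<close> ball_measure_nonneg by (auto simp: \<epsilon>_def field_simps)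
    obtain \<delta> where d: "\<delta> > 0" "\<And>n s s'. n \<in> I \<Longrightarrow>
       x < s \<and> s < x + \<delta> \<and> x < s' \<and> s' < x + \<delta> \<or>
       x - \<delta> < s \<and> s < x \<and> x - \<delta> < s' \<and> s' < x \<Longrightarrow> norm (g n s - g n s') < \<epsilon>"
      using reg e(1) unfolding equi_regulated_def by (metis imageI)
    have small: "?X u v \<le> integral {u..v} h + \<eta> * (v - u)"
      if "u \<le> v" "u = x \<and> v < x + \<delta> \<or> v = x \<and> x - \<delta> < u" for u v
    proof -
      have "?X u v \<le> integral {u..v} h + \<epsilon> * ball_measure * (v - u)"
      proof (rule integral_small_oscillation[OF I int bd' h that(1)])
        fix n s s' assume "n \<in> I" "u < s" "s < v" "u < s'" "s' < v"
        then show "norm (g n s - g n s') \<le> \<epsilon>" using that(2) by (intro less_imp_le d(2)) auto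
      qed (use e in auto)
      also have "\<dots> \<le> integral {u..v} h + \<eta> * (v - u)"
        using e(2) that(1) by (simp add: mult_right_mono)
      finally show ?thesis .
    qed
    show ?case
    proof (intro exI[of _ \<delta>] conjI allI impI)
      fix u v assume uv: "u \<le> x \<and> x \<le> v \<and> v - u < \<delta>"
      show "?X u v \<le> integral {u..v} h + \<eta> * (v - u)"
        by (rule split[of u x _ v]) (use uv small[of u x] small[of x v] in auto)
    qed (use d in simp)
  qed
  show ?thesis
  proof (rule field_le_epsilon)
    fix e :: real assume "e > 0"
    have "?X p q \<le> integral {p..q} h + e / (q - p + 1) * (q - p)"
      using \<open>e > 0\<close> pq by (intro main) auto
    also have "e / (q - p + 1) * (q - p) \<le> e" using \<open>e > 0\<close> pq by (simp add: field_simps)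
    finally show "?X p q \<le> integral {p..q} h + e" by simp
  qed
qed

end

section \<open>Compactness for equi-Lipschitz sequences\<close>

lemma equi_lipschitz_limit:
  fixes u :: "nat \<Rightarrow> real \<Rightarrow> 'e::real_normed_vector"
  assumes "\<And>n. norm (u n s - u n t) \<le> B" "(\<lambda>n. u n s) \<longlonglongrightarrow> l s" "(\<lambda>n. u n t) \<longlonglongrightarrow> l t"
  shows "norm (l s - l t) \<le> B"
  by (rule LIMSEQ_le_const2[OF tendsto_norm[OF tendsto_diff[OF assms(2,3)]]]) (use assms(1) in blast)

text \<open>Convergence on a finite \<open>\<delta>\<close>-net spreads to the whole compact set,
  since the common Lipschitz constant is inherited by the limit.\<close>

lemma equi_lipschitz_uniform_limit:
  fixes u :: "nat \<Rightarrow> real \<Rightarrow> 'e::real_normed_vector"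
  assumes S: "compact S" and L: "L \<ge> 0"
    and lip: "\<And>n s t. s \<in> S \<Longrightarrow> t \<in> S \<Longrightarrow> norm (u n s - u n t) \<le> L * \<bar>s - t\<bar>"
    and lim: "\<And>t. t \<in> S \<Longrightarrow> (\<lambda>n. u n t) \<longlonglongrightarrow> l t"
    and e: "\<epsilon> > 0"
  shows "\<forall>\<^sub>F n in sequentially. \<forall>t\<in>S. norm (u n t - l t) < \<epsilon>"
proof -
  define \<delta> where "\<delta> = \<epsilon> / (3 * (L + 1))"
  have d: "\<delta> > 0" "L * \<delta> < \<epsilon> / 3" using e L by (auto simp: \<delta>_def field_simps)
  obtain K where K: "finite K" "K \<subseteq> S" "S \<subseteq> (\<Union>x\<in>K. ball x \<delta>)"
    using S d(1) seq_compact_imp_totally_bounded compact_imp_seq_compact by metis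
  have "\<forall>\<^sub>F n in sequentially. dist (u n x) (l x) < \<epsilon> / 3" if "x \<in> K" for x
    using lim[of x] that K(2) e by (intro tendstoD) auto
  then have "\<forall>\<^sub>F n in sequentially. \<forall>x\<in>K. norm (u n x - l x) < \<epsilon> / 3"
    using K(1) by (simp add: eventually_ball_finite dist_norm)
  then show ?thesis
  proof eventually_elim
    case (elim n)
    show ?case
    proof
      fix t assume t: "t \<in> S"
      then obtain x where x: "x \<in> K" "\<bar>x - t\<bar> < \<delta>" using K(3) by (auto simp: dist_real_def)
      then have xS: "x \<in> S" using K by auto
      have "norm (u n t - u n x) \<le> L * \<bar>t - x\<bar>" using lip t xS by blast
      moreover have "norm (l x - l t) \<le> L * \<bar>x - t\<bar>"
        using equi_lipschitz_limit[of u x t _ l] lip[OF xS t] lim t xS by blast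
      moreover have "L * \<bar>x - t\<bar> \<le> L * \<delta>" "L * \<bar>t - x\<bar> \<le> L * \<delta>"
        using x(2) L by (auto intro!: mult_left_mono)
      moreover have "norm (u n t - l t) \<le> norm (u n t - u n x) + norm (u n x - l x) + norm (l x - l t)"
        using norm_triangle_ineq[of "u n t - u n x" "u n x - l x"]
          norm_triangle_ineq[of "u n t - l x" "l x - l t"] by simp
      ultimately show "norm (u n t - l t) < \<epsilon>" using elim x(1) d(2) by force
    qed
  qed
qed

lemma cluster_point_subseq:
  fixes x :: "nat \<Rightarrow> 'a::metric_space"
  assumes "\<And>k. l \<in> closure (x ` {k..})"
  obtains r :: "nat \<Rightarrow> nat" where "strict_mono r" "(x \<circ> r) \<longlonglongrightarrow> l"
proof -
  have ex: "\<exists>j>m. dist (x j) l < 1 / real (Suc k)" for m k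
  proof -
    have "\<exists>y\<in>x ` {Suc m..}. dist y l < 1 / real (Suc k)"
      using assms[of "Suc m"] unfolding closure_approachable by (meson divide_pos_pos of_nat_0_less_iff zero_less_Suc zero_less_one)
    then show ?thesis by (auto simp: Suc_le_eq)
  qed
  have "\<exists>r::nat\<Rightarrow>nat. \<forall>n. dist (x (r n)) l < 1 / real (Suc n) \<and> r n < r (Suc n)"
    by (rule dependent_nat_choice) (use ex in blast)+
  then obtain r :: "nat \<Rightarrow> nat" where r: "\<And>n. dist (x (r n)) l < 1 / real (Suc n)" "\<And>n. r n < r (Suc n)"
    by blast
  have "(\<lambda>n. dist (x (r n)) l) \<longlonglongrightarrow> 0"
    by (rule real_tendsto_sandwich[OF _ _ tendsto_const LIMSEQ_inverse_real_of_nat])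
      (use r(1) in \<open>auto simp: inverse_eq_divide less_imp_le intro!: always_eventually\<close>)
  then have "(x \<circ> r) \<longlonglongrightarrow> l" by (subst tendsto_dist_iff) (simp add: o_def)
  moreover have "strict_mono r" using r(2) by (simp add: strict_mono_Suc_iff)
  ultimately show ?thesis using that by blast
qed

lemma norm_integral_diff_le:
  fixes g h :: "real \<Rightarrow> 'e::banach"
  assumes "g integrable_on {p..q}" "h integrable_on {p..q}" "p \<le> q" "\<eta> \<ge> 0"
    "\<And>s. p < s \<Longrightarrow> s < q \<Longrightarrow> norm (g s - h s) \<le> \<eta>"
  shows "norm (integral {p..q} g - integral {p..q} h) \<le> \<eta> * (q - p)"
  using norm_integral_minus_const[of "\<lambda>s. g s - h s" p q \<eta> 0] assms
    Henstock_Kurzweil_Integration.integral_diff[OF assms(1,2)]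
    Henstock_Kurzweil_Integration.integrable_diff[OF assms(1,2)] by simp

context sublinear_measure
begin

lemma convergent_subseq:
  fixes x :: "nat \<Rightarrow> 'e" and s :: "nat \<Rightarrow> nat"
  assumes "bounded (range x)" "(\<lambda>k. \<mu> (x ` {k..})) \<longlonglongrightarrow> 0" "strict_mono s"
  shows "\<exists>r. strict_mono r \<and> convergent (x \<circ> (s \<circ> r))"
proof -
  let ?X = "\<lambda>k. (x \<circ> s) ` {k..}"
  have sub: "?X k \<subseteq> x ` {k..}" for k
  proof -
    have "j \<le> s j" for j using seq_suble[OF assms(3)] .
    then show ?thesis by (force intro: order_trans)
  qed
  have bd: "bounded (x ` {k..})" for k by (rule bounded_subset[OF assms(1)]) auto
  have bd': "bounded (?X k)" for k using bounded_subset[OF bd sub] .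
  have eq: "\<mu> (closure (?X k)) = \<mu> (?X k)" for k
    using mnc bd' by (simp add: measure_of_noncompactness_def nonempty_bounded_def)
  have lim: "(\<lambda>k. \<mu> (closure (?X k))) \<longlonglongrightarrow> 0"
  proof (rule real_tendsto_sandwich[OF _ _ tendsto_const assms(2)])
    show "\<forall>\<^sub>F k in sequentially. 0 \<le> \<mu> (closure (?X k))"
      unfolding eq using bd' by (intro always_eventually allI nonneg) auto
    show "\<forall>\<^sub>F k in sequentially. \<mu> (closure (?X k)) \<le> \<mu> (x ` {k..})"
      unfolding eq by (intro always_eventually allI mono sub bd) auto
  qed
  have nested: "\<forall>k. closure (?X k) \<in> nonempty_bounded \<and> closed (closure (?X k)) \<and>
      closure (?X (Suc k)) \<subseteq> closure (?X k)"
    using bd' by (auto simp: nonempty_bounded_def intro!: bounded_closure closure_mono image_mono)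
  have "\<forall>X :: nat \<Rightarrow> 'e set. (\<forall>k. X k \<in> nonempty_bounded \<and> closed (X k) \<and> X (Suc k) \<subseteq> X k) \<and>
        (\<lambda>k. \<mu> (X k)) \<longlonglongrightarrow> 0 \<longrightarrow> (\<Inter>k. X k) \<noteq> {}"
    using mnc unfolding measure_of_noncompactness_def by (elim conjE)
  from this[rule_format, OF conjI[OF nested lim]] have "(\<Inter>k. closure (?X k)) \<noteq> {}" .
  then obtain l where "\<And>k. l \<in> closure (?X k)" by blast
  then obtain r where "strict_mono r" "((x \<circ> s) \<circ> r) \<longlonglongrightarrow> l" by (rule cluster_point_subseq)
  then show ?thesis by (auto simp: convergent_def o_assoc)
qed

text \<open>The diagonal sequence converges on a countable dense subset of \<open>S\<close>; the
  common Lipschitz constant makes it Cauchy at every other point, and completeness does the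
  rest.\<close>

lemma equi_lipschitz_convergent_subseq:
  fixes u :: "nat \<Rightarrow> real \<Rightarrow> 'e"
  assumes L: "L \<ge> 0"
    and lip: "\<And>n s t. s \<in> S \<Longrightarrow> t \<in> S \<Longrightarrow> norm (u n s - u n t) \<le> L * \<bar>s - t\<bar>"
    and bd: "\<And>t. t \<in> S \<Longrightarrow> bounded (range (\<lambda>n. u n t))"
    and tail: "\<And>t. t \<in> S \<Longrightarrow> (\<lambda>k. \<mu> ((\<lambda>n. u n t) ` {k..})) \<longlonglongrightarrow> 0"
  obtains r :: "nat \<Rightarrow> nat" where "strict_mono r" "\<And>t. t \<in> S \<Longrightarrow> convergent (\<lambda>j. u (r j) t)"
proof (cases "S = {}")
  case True
  then show ?thesis using that[of id] by (auto simp: strict_mono_def)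
next
  case False
  obtain D where D: "countable D" "D \<subseteq> S" "S \<subseteq> closure D" using separable .
  then have ne: "D \<noteq> {}" using False by auto
  define t where "t = from_nat_into D"
  have tS: "t n \<in> S" for n using from_nat_into[OF ne] D(2) by (auto simp: t_def)
  interpret diag: subseqs "\<lambda>n s. convergent (\<lambda>j. u (s j) (t n))"
  proof
    fix n s assume "strict_mono (s :: nat \<Rightarrow> nat)"
    then show "\<exists>r. strict_mono r \<and> convergent (\<lambda>j. u ((s \<circ> r) j) (t n))"
      using convergent_subseq[OF bd[OF tS] tail[OF tS], of s n] by (simp add: o_def)
  qed
  define r where "r = diag.diagseq"
  have conv: "convergent (\<lambda>j. u (r j) (t n))" for n
  proof -
    have "convergent (\<lambda>j. u ((r \<circ> (+) (Suc n)) j) (t n))"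
      unfolding r_def
    proof (rule diag.diagseq_holds)
      fix q s n assume q: "strict_mono (q :: nat \<Rightarrow> nat)" and c: "convergent (\<lambda>j. u (s j) (t n))"
      show "convergent (\<lambda>j. u ((s \<circ> q) j) (t n))"
        using convergent_subseq_convergent[OF c q] by (simp add: o_def)
    qed
    \<comment> \<open>Only from index \<open>Suc n\<close> on is the diagonal sequence a subsequence
      of the one chosen for \<open>t n\<close>.\<close>
    then have "convergent (\<lambda>j. u (r (j + Suc n)) (t n))" by (simp add: o_def add.commute)
    then show ?thesis using convergent_ignore_initial_segment[of "\<lambda>j. u (r j) (t n)" "Suc n"] by simp
  qed
  have "convergent (\<lambda>j. u (r j) x)" if x: "x \<in> S" for x
    unfolding Cauchy_convergent_iff[symmetric] Cauchy_def
  proof (intro allI impI)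
    fix e :: real assume e: "e > 0"
    define \<delta> where "\<delta> = e / (3 * (L + 1))"
    have d: "\<delta> > 0" "L * \<delta> < e / 3" using e L by (auto simp: \<delta>_def field_simps)
    obtain y where "y \<in> D" "dist y x < \<delta>"
      using D(3) x d(1) closure_approachable by blast
    then obtain n where n: "\<bar>t n - x\<bar> < \<delta>"
      using from_nat_into_surj[OF D(1)] unfolding t_def dist_real_def by metis
    have close: "norm (u k x - u k (t n)) < e / 3" for k
    proof -
      have "norm (u k x - u k (t n)) \<le> L * \<bar>x - t n\<bar>" using lip x tS by blast
      also have "\<dots> \<le> L * \<delta>" using n L by (intro mult_left_mono) auto
      finally show ?thesis using d(2) by simp
    qed
    have "Cauchy (\<lambda>j. u (r j) (t n))" using conv Cauchy_convergent_iff by blast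
    then obtain N where N: "\<forall>i\<ge>N. \<forall>j\<ge>N. dist (u (r i) (t n)) (u (r j) (t n)) < e / 3"
      unfolding Cauchy_def using e by (meson divide_pos_pos zero_less_numeral)
    show "\<exists>N. \<forall>i\<ge>N. \<forall>j\<ge>N. dist (u (r i) x) (u (r j) x) < e"
    proof (intro exI[of _ N] allI impI)
      fix i j assume "i \<ge> N" "j \<ge> N"
      then have "dist (u (r i) (t n)) (u (r j) (t n)) < e / 3" using N by blast
      moreover have "dist (u (r i) x) (u (r i) (t n)) < e / 3" "dist (u (r j) (t n)) (u (r j) x) < e / 3"
        using close[of "r i"] close[of "r j"] by (simp_all add: dist_norm norm_minus_commute)
      ultimately show "dist (u (r i) x) (u (r j) x) < e"
        using dist_triangle[of "u (r i) x" "u (r j) x" "u (r i) (t n)"]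
          dist_triangle[of "u (r i) (t n)" "u (r j) x" "u (r j) (t n)"] by linarith
    qed
  qed
  moreover have "strict_mono r" unfolding r_def by (rule diag.subseq_diagseq)
  ultimately show ?thesis using that by blast
qed

end

section \<open>Delayed approximations and their limit\<close>

locale kamke_ivp = compact_time_scale J a b + sublinear_measure \<mu>
  for J :: "real set" and a b :: real and \<mu> :: "'e::banach set \<Rightarrow> real" +
  fixes f :: "real \<Rightarrow> 'e \<Rightarrow> 'e" and u0 :: 'e and \<beta> M d :: real and w :: "real \<Rightarrow> real \<Rightarrow> real"
  assumes d_in: "d \<in> J" and M_pos: "M > 0" and d_le: "M * (d - a) \<le> \<beta>"
    and f_rd: "\<And>t. t \<in> J \<Longrightarrow> equi_rd_at J ((\<lambda>x t. f t x) ` cball u0 \<beta>) t"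
    and f_equi: "uniformly_equicontinuous_on (cball u0 \<beta>) (f ` J)"
    and f_bound: "\<And>t x. t \<in> J \<Longrightarrow> x \<in> cball u0 \<beta> \<Longrightarrow> norm (f t x) \<le> M"
    and f_mu: "\<And>t X. t \<in> J \<Longrightarrow> X \<noteq> {} \<Longrightarrow> X \<subseteq> cball u0 \<beta> \<Longrightarrow> \<mu> (f t ` X) \<le> w t (\<mu> X)"
    and mu_u0: "\<mu> {u0} = 0"
    and w_nonneg: "\<And>t x. t \<in> J \<Longrightarrow> x \<ge> 0 \<Longrightarrow> w t x \<ge> 0"
    and w_rd: "\<And>x. x \<ge> 0 \<Longrightarrow> rd_continuous_on J (\<lambda>t. w t x)"
    and w_equi: "\<And>x. x > 0 \<Longrightarrow> uniformly_equicontinuous_on {0..x} (w ` J)"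
    and w_zero: "\<And>t. t \<in> J \<Longrightarrow> w t 0 = 0"
    and w_unique: "\<And>v :: real \<Rightarrow> real. continuous_on J v \<Longrightarrow> (\<And>t. t \<in> J \<Longrightarrow> v t \<ge> 0) \<Longrightarrow>
        (\<And>t. t \<in> J \<Longrightarrow> v t \<le> delta_integral J a t (\<lambda>s. w s (v s))) \<Longrightarrow>
        has_delta_derivative J v 0 a \<Longrightarrow> (\<And>t. t \<in> J \<Longrightarrow> v t = 0)"
begin

text \<open>The Lipschitz bound is what makes \<open>s \<mapsto> f s (y s)\<close> rd-continuous,
  uniformly in \<open>y\<close>. The domain varies: delayed arguments leave \<open>J\<close>, even
  to the left of \<open>a\<close>, so the approximations need all of the reals, while their limit is
  available on \<open>J\<close> only.\<close>

definition admissible :: "real set \<Rightarrow> (real \<Rightarrow> 'e) \<Rightarrow> bool" where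
  "admissible S y \<longleftrightarrow> (\<forall>s\<in>S. y s \<in> cball u0 \<beta>) \<and> (\<forall>s\<in>S. \<forall>t\<in>S. norm (y s - y t) \<le> M * \<bar>s - t\<bar>)"

lemma admissible_subset: "admissible S y \<Longrightarrow> S' \<subseteq> S \<Longrightarrow> admissible S' y"
  unfolding admissible_def by blast

lemma lipschitz_equicontinuous:
  fixes Y :: "(real \<Rightarrow> 'x::metric_space) set"
  assumes "\<And>y s. y \<in> Y \<Longrightarrow> s \<in> J \<Longrightarrow> dist (y s) (y t) \<le> L * \<bar>s - t\<bar>" "\<epsilon> > 0" "L \<ge> 0"
  shows "\<exists>\<delta>>0. \<forall>y\<in>Y. \<forall>s\<in>J. \<bar>s - t\<bar> < \<delta> \<longrightarrow> dist (y s) (y t) < \<epsilon>"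
proof (intro exI[of _ "\<epsilon> / (L + 1)"] conjI ballI impI)
  fix y s assume "y \<in> Y" "s \<in> J" "\<bar>s - t\<bar> < \<epsilon> / (L + 1)"
  then have "(L + 1) * \<bar>s - t\<bar> < \<epsilon>" using assms(3) by (simp add: field_simps)
  moreover have "L * \<bar>s - t\<bar> \<le> (L + 1) * \<bar>s - t\<bar>" by (simp add: mult_right_mono)
  ultimately show "dist (y s) (y t) < \<epsilon>" using assms(1)[OF \<open>y \<in> Y\<close> \<open>s \<in> J\<close>] by linarith
qed (use assms in simp)

lemma rhs_equi_rd:
  assumes "\<And>y. y \<in> Y \<Longrightarrow> admissible J y" "t \<in> J"
  shows "equi_rd_at J ((\<lambda>y s. f s (y s)) ` Y) t"
proof (rule equi_rd_at_comp[OF assms(2) _ f_equi])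
  show "equi_rd_at J ((\<lambda>y s. f s (y t)) ` Y) t"
    by (rule equi_rd_at_mono[OF f_rd[OF assms(2)]]) (use assms in \<open>auto simp: admissible_def\<close>)
  show "y s \<in> cball u0 \<beta>" if "y \<in> Y" "s \<in> J" for y s
    using assms(1)[OF that(1)] that(2) by (auto simp: admissible_def)
  show "\<exists>\<delta>>0. \<forall>y\<in>Y. \<forall>s\<in>J. \<bar>s - t\<bar> < \<delta> \<longrightarrow> dist (y s) (y t) < \<epsilon>" if "\<epsilon> > 0" for \<epsilon>
  proof (rule lipschitz_equicontinuous[OF _ that less_imp_le[OF M_pos]])
    show "dist (y s) (y t) \<le> M * \<bar>s - t\<bar>" if "y \<in> Y" "s \<in> J" for y s
      using assms(1)[OF that(1)] that(2) assms(2) by (auto simp: admissible_def dist_norm)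
  qed
qed

lemma rhs_equi_rd_single: "admissible J y \<Longrightarrow> t \<in> J \<Longrightarrow> equi_rd_at J {\<lambda>s. f s (y s)} t"
  using rhs_equi_rd[of "{y}"] by simp

lemma rhs_integrable: "admissible J y \<Longrightarrow> (\<lambda>s. f (\<pi> s) (y (\<pi> s))) integrable_on {p..q}"
  using floor_integrable[of "\<lambda>s. f s (y s)"] rhs_equi_rd_single by blast

lemma w_comp_equi_rd:
  assumes v: "\<And>s. s \<in> J \<Longrightarrow> v s \<in> {0..R}" "\<And>s t. s \<in> J \<Longrightarrow> t \<in> J \<Longrightarrow> \<bar>v s - v t\<bar> \<le> L * \<bar>s - t\<bar>"
    and "R > 0" "L \<ge> 0" "t \<in> J"
  shows "equi_rd_at J {\<lambda>s. w s (v s)} t"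
proof -
  have "equi_rd_at J ((\<lambda>y s. w s (y s)) ` {v}) t"
  proof (rule equi_rd_at_comp[OF \<open>t \<in> J\<close> _ w_equi[OF \<open>R > 0\<close>]])
    show "equi_rd_at J ((\<lambda>y s. w s (y t)) ` {v}) t"
      using rd_continuous_imp_equi_rd_at[OF w_rd[of "v t"]] v(1) assms(5) by simp
    show "\<exists>\<delta>>0. \<forall>y\<in>{v}. \<forall>s\<in>J. \<bar>s - t\<bar> < \<delta> \<longrightarrow> dist (y s) (y t) < \<epsilon>" if "\<epsilon> > 0" for \<epsilon>
      by (rule lipschitz_equicontinuous[OF _ that \<open>L \<ge> 0\<close>]) (use v(2) assms(5) in \<open>auto simp: dist_real_def\<close>)
  qed (use v(1) in auto)
  then show ?thesis by simp
qed

text \<open>As the upper limit of an integral it makes functions constant beyond \<open>d\<close>,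
  where the bound \<open>M * (d - a) \<le> \<beta>\<close> no longer keeps them in the ball, and
  equal to \<open>u0\<close> to the left of \<open>a\<close>.\<close>

definition clamp :: "real \<Rightarrow> real" where "clamp t = max a (min t d)"

lemma clamp: "a \<le> clamp t" "clamp t \<le> d" "\<bar>clamp s - clamp t\<bar> \<le> \<bar>s - t\<bar>"
    "a \<le> t \<Longrightarrow> clamp t \<le> t" "a \<le> t \<Longrightarrow> t \<le> d \<Longrightarrow> clamp t = t" "s \<le> t \<Longrightarrow> clamp s \<le> clamp t"
    "t \<le> a \<Longrightarrow> clamp t = a"
  using in_bounds[OF d_in] by (auto simp: clamp_def)

lemma beta_nonneg: "\<beta> \<ge> 0"
  using d_le M_pos in_bounds(1)[OF d_in] by (meson diff_ge_0_iff_ge less_imp_le mult_nonneg_nonneg order_trans)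

lemma admissible_integral:
  assumes int: "\<And>p q. g integrable_on {p..q}" and bd: "\<And>s. norm (g s) \<le> M"
  shows "admissible UNIV (\<lambda>t. u0 + integral {a..clamp t} g)"
proof -
  have le: "norm (integral {p..q} g) \<le> M * (q - p)" if "p \<le> q" for p q
    using norm_integral_minus_const[OF int that, of M 0] bd M_pos by simp
  have ord: "norm (integral {a..clamp t} g - integral {a..clamp s} g) \<le> M * \<bar>s - t\<bar>" if "s \<le> t" for s t
  proof -
    have "norm (integral {a..clamp t} g - integral {a..clamp s} g) \<le> M * (clamp t - clamp s)"
      using integral_diff_ivl[OF int clamp(1) clamp(6)[OF that]] le[OF clamp(6)[OF that]] by simp
    also have "\<dots> \<le> M * \<bar>s - t\<bar>"
      using M_pos clamp(3)[of s t] clamp(6)[OF that] by (intro mult_left_mono) auto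
    finally show ?thesis .
  qed
  have "norm ((u0 + integral {a..clamp s} g) - (u0 + integral {a..clamp t} g)) \<le> M * \<bar>s - t\<bar>" for s t
    using ord[of s t] ord[of t s] by (cases "s \<le> t") (auto simp: norm_minus_commute abs_minus_commute)
  moreover have "u0 + integral {a..clamp t} g \<in> cball u0 \<beta>" for t
  proof -
    have "norm (integral {a..clamp t} g) \<le> M * (clamp t - a)" using le clamp(1) by blast
    also have "\<dots> \<le> M * (d - a)" using clamp(2) M_pos by simp
    finally show ?thesis using d_le by (simp add: dist_norm)
  qed
  ultimately show ?thesis by (simp add: admissible_def)
qed

text \<open>The iterates of \<open>delay_op h\<close> gain one interval of length \<open>h\<close> on which they are stationary, so
  finitely many of them reach a fixed point on \<open>{..b}\<close>.\<close>

definition delay_op :: "real \<Rightarrow> (real \<Rightarrow> 'e) \<Rightarrow> real \<Rightarrow> 'e" where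
  "delay_op h y t = u0 + integral {a..clamp t} (\<lambda>s. f (\<pi> s) (y (\<pi> s - h)))"

lemma admissible_delay: "admissible UNIV y \<Longrightarrow> admissible J (\<lambda>s. y (s - h))"
  unfolding admissible_def by (metis UNIV_I diff_diff_eq2 diff_add_cancel)

lemma admissible_delay_op:
  assumes "admissible UNIV y" shows "admissible UNIV (delay_op h y)"
proof -
  have "norm (f (\<pi> s) (y (\<pi> s - h))) \<le> M" for s
    using assms f_bound[OF floor_in] by (auto simp: admissible_def)
  then show ?thesis
    unfolding delay_op_def using rhs_integrable[OF admissible_delay[OF assms]]
    by (intro admissible_integral)
qed

lemma delay_solution:
  assumes "h > 0" obtains y where "admissible UNIV y" "\<And>t. t \<le> b \<Longrightarrow> y t = delay_op h y t"
proof -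
  define y where "y j = (delay_op h ^^ j) (\<lambda>_. u0)" for j
  have adm: "admissible UNIV (y j)" for j
  proof (induction j)
    case 0
    then show ?case using beta_nonneg M_pos by (auto simp: y_def admissible_def)
  next
    case (Suc j)
    then show ?case using admissible_delay_op by (simp add: y_def)
  qed
  \<comment> \<open>Up to \<open>a\<close> every iterate equals \<open>u0\<close>. For
    \<open>t \<le> a + (j + 1) * h\<close> the integrand only looks at
    \<open>\<pi> s - h \<le> t - h\<close>, where the previous two iterates already agree; if
    \<open>t < a\<close>, the integral reduces to the point \<open>a\<close>.\<close>
  have stable: "y (Suc j) t = y j t" if "t \<le> a + real j * h" for j t
    using that
  proof (induction j arbitrary: t)
    case 0
    then show ?case by (simp add: y_def delay_op_def clamp)
  next
    case (Suc j)
    have "integral {a..clamp t} (\<lambda>s. f (\<pi> s) (y (Suc j) (\<pi> s - h)))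
        = integral {a..clamp t} (\<lambda>s. f (\<pi> s) (y j (\<pi> s - h)))"
    proof (rule Henstock_Kurzweil_Integration.integral_cong)
      fix s assume s: "s \<in> {a..clamp t}"
      show "f (\<pi> s) (y (Suc j) (\<pi> s - h)) = f (\<pi> s) (y j (\<pi> s - h))"
      proof (cases "a \<le> t")
        case True
        then have "\<pi> s - h \<le> a + real j * h"
          using s floor_le[of s] clamp(4)[OF True] Suc.prems by (auto simp: algebra_simps)
        then show ?thesis using Suc.IH by simp
      next
        case False
        then have "s = a" using s clamp(7)[of t] by simp
        then have "\<pi> s = a" using floor_id[OF a_in] by simp
        moreover have "real j * h \<ge> 0" using assms by simp
        ultimately have "\<pi> s - h \<le> a + real j * h" using assms by linarith
        then show ?thesis using Suc.IH by simp
      qed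
    qed
    then show ?case by (simp add: y_def delay_op_def)
  qed
  obtain N :: nat where "b - a \<le> real N * h"
    using ex_less_of_nat_mult[OF assms, of "b - a"] by (auto intro: less_imp_le)
  then have "y N t = delay_op h (y N) t" if "t \<le> b" for t
    using stable[of t N] that by (simp add: y_def)
  then show ?thesis using that adm by blast
qed

definition approx :: "nat \<Rightarrow> real \<Rightarrow> 'e" where
  "approx n = (SOME y. admissible UNIV y \<and> (\<forall>t\<le>b. y t = delay_op (1 / real (Suc n)) y t))"

lemma approx: "admissible UNIV (approx n)" "t \<le> b \<Longrightarrow> approx n t = delay_op (1 / real (Suc n)) (approx n) t"
proof -
  have "\<exists>y. admissible UNIV y \<and> (\<forall>t\<le>b. y t = delay_op (1 / real (Suc n)) y t)"
    using delay_solution[of "1 / real (Suc n)"] by (metis divide_pos_pos of_nat_0_less_iff zero_less_Suc zero_less_one)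
  then have "admissible UNIV (approx n) \<and> (\<forall>t\<le>b. approx n t = delay_op (1 / real (Suc n)) (approx n) t)"
    unfolding approx_def by (rule someI_ex)
  then show "admissible UNIV (approx n)"
    "t \<le> b \<Longrightarrow> approx n t = delay_op (1 / real (Suc n)) (approx n) t" by auto
qed

lemma approx_ball: "approx n t \<in> cball u0 \<beta>"
  and approx_lipschitz: "norm (approx n s - approx n t) \<le> M * \<bar>s - t\<bar>"
  using approx(1)[of n] by (auto simp: admissible_def)

lemma approx_J: "admissible J (approx n)"
  using approx(1) admissible_subset by blast

lemma approx_rhs_bound: "norm (f (\<pi> s) (approx n (\<pi> s))) \<le> M"
  using f_bound[OF floor_in approx_ball] .

lemma delay_small:
  assumes "\<delta> > 0" obtains N where "\<And>n. n \<ge> N \<Longrightarrow> M * (1 / real (Suc n)) < \<delta>"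
proof -
  obtain N where N: "M / \<delta> < real N" using reals_Archimedean2 by blast
  have "M * (1 / real (Suc n)) < \<delta>" if "n \<ge> N" for n
  proof -
    have "M / \<delta> < real (Suc n)" using N that by simp
    then show ?thesis using assms by (simp add: field_simps)
  qed
  then show ?thesis using that by blast
qed

text \<open>Tails are used because the delay error becomes small only for large \<open>n\<close>,
  and \<mu> is not assumed to ignore finitely many members of a set. Their measures decrease in
  \<open>k\<close>, which provides a limit.\<close>

definition tail_measure :: "nat \<Rightarrow> real \<Rightarrow> real" where
  "tail_measure k t = \<mu> ((\<lambda>n. approx n t) ` {k..})"

text \<open>A common bound for all tail measures; the summand 1 makes it positive, as equicontinuity
  of \<open>w\<close> on \<open>{0..x}\<close> is given for positive \<open>x\<close>.\<close>

definition R :: real where "R = \<mu> (cball u0 \<beta>) + 1"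

definition L :: real where "L = M * ball_measure"

lemma bounded_tail: "bounded ((\<lambda>n. approx n t) ` I)"
  using approx_ball by (intro bounded_subset[OF bounded_cball[of u0 \<beta>]]) auto

lemma R_pos: "R > 0"
  using nonneg[of "cball u0 \<beta>"] beta_nonneg by (simp add: R_def)

lemma L_nonneg: "L \<ge> 0"
  using ball_measure_nonneg M_pos by (simp add: L_def)

lemma tail_measure_range: "tail_measure k t \<in> {0..R}"
proof -
  have "0 \<le> tail_measure k t" unfolding tail_measure_def by (intro nonneg bounded_tail) simp
  moreover have "tail_measure k t \<le> \<mu> (cball u0 \<beta>)"
    unfolding tail_measure_def using approx_ball by (intro mono) auto
  ultimately show ?thesis by (simp add: R_def)
qed

lemma tail_measure_lipschitz: "\<bar>tail_measure k s - tail_measure k t\<bar> \<le> L * \<bar>s - t\<bar>"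
proof -
  have "tail_measure k s \<le> tail_measure k t + L * \<bar>s - t\<bar>" for s t
    using near[OF _ bounded_tail, of "{k..}" "M * \<bar>s - t\<bar>" "\<lambda>n. approx n s" t] approx_lipschitz M_pos
    by (simp add: tail_measure_def L_def mult.assoc mult.left_commute mult.commute)
  from this[of s t] this[of t s] show ?thesis by (simp add: abs_le_iff abs_minus_commute)
qed

lemma w_comp_integrable:
  assumes "\<And>s. s \<in> J \<Longrightarrow> v s \<in> {0..R}" "\<And>s t. s \<in> J \<Longrightarrow> t \<in> J \<Longrightarrow> \<bar>v s - v t\<bar> \<le> L * \<bar>s - t\<bar>"
  shows "(\<lambda>s. w (\<pi> s) (v (\<pi> s))) integrable_on {p..q}"
  using floor_integrable[of "\<lambda>s. w s (v s)"] w_comp_equi_rd[OF assms R_pos L_nonneg] by blast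

text \<open>A delay of \<open>1 / (n + 1)\<close> moves an approximation by at most
  \<open>M / (n + 1)\<close>, so for large \<open>n\<close> equicontinuity of \<open>f\<close> makes
  removing the delay cheap, and \<open>near\<close> converts the cost into measure. What remains are
  integrals of undelayed right-hand sides, to which \<open>integral_le\<close> and the bound by
  \<open>w\<close> apply.\<close>

lemma tail_measure_le:
  assumes "\<eta> > 0"
  obtains N where "\<And>k t. k \<ge> N \<Longrightarrow> t \<le> b \<Longrightarrow>
    tail_measure k t \<le> integral {a..clamp t} (\<lambda>s. w (\<pi> s) (tail_measure k (\<pi> s))) + \<eta>"
proof -
  define \<epsilon> where "\<epsilon> = \<eta> / ((b - a) * ball_measure + 1)"
  have den: "(b - a) * ball_measure + 1 > 0"
    using a_le_b ball_measure_nonneg by (intro add_nonneg_pos mult_nonneg_nonneg) auto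
  have e: "\<epsilon> > 0" using assms den by (simp add: \<epsilon>_def)
  have "\<epsilon> * ((b - a) * ball_measure + 1) = \<eta>" using den by (simp add: \<epsilon>_def)
  then have e': "\<epsilon> * ((b - a) * ball_measure) \<le> \<eta>" using e by (simp add: algebra_simps)
  obtain \<delta> where d: "\<delta> > 0" "\<And>g x y. g \<in> f ` J \<Longrightarrow> x \<in> cball u0 \<beta> \<Longrightarrow> y \<in> cball u0 \<beta> \<Longrightarrow>
      dist x y < \<delta> \<Longrightarrow> dist (g x) (g y) < \<epsilon>"
    using uniformly_equicontinuous_onE[OF f_equi e] by blast
  obtain N where N: "\<And>n. n \<ge> N \<Longrightarrow> M * (1 / real (Suc n)) < \<delta>" using delay_small[OF d(1)] by blast
  have "tail_measure k t \<le> integral {a..clamp t} (\<lambda>s. w (\<pi> s) (tail_measure k (\<pi> s))) + \<eta>"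
    if k: "k \<ge> N" and t: "t \<le> b" for k t
  proof -
    let ?g = "\<lambda>n s. f (\<pi> s) (approx n (\<pi> s))"
    let ?I = "\<lambda>n. integral {a..clamp t} (?g n)"
    have bI: "bounded (?I ` {k..})"
      using rhs_integrable[OF approx_J] approx_rhs_bound M_pos by (intro bounded_integrals[of _ _ M]) auto
    have "tail_measure k t \<le> \<mu> ((\<lambda>n. u0 + ?I n) ` {k..}) + \<epsilon> * (b - a) * ball_measure"
      unfolding tail_measure_def
    proof (rule near)
      have "bounded ((\<lambda>v. u0 + v) ` ?I ` {k..})" by (intro bounded_translation bI)
      then show "bounded ((\<lambda>n. u0 + ?I n) ` {k..})" by (simp add: image_image)
      fix n assume "n \<in> {k..}"
      then have n: "M * (1 / real (Suc n)) < \<delta>" using N k by simp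
      have "norm (integral {a..clamp t} (\<lambda>s. f (\<pi> s) (approx n (\<pi> s - 1 / real (Suc n)))) - ?I n)
          \<le> \<epsilon> * (clamp t - a)"
      proof (rule norm_integral_diff_le[OF _ _ clamp(1)])
        show "(\<lambda>s. f (\<pi> s) (approx n (\<pi> s - 1 / real (Suc n)))) integrable_on {a..clamp t}"
          using rhs_integrable[OF admissible_delay[OF approx(1)]] .
        show "?g n integrable_on {a..clamp t}" using rhs_integrable[OF approx_J] .
        fix s
        have "dist (approx n (\<pi> s - 1 / real (Suc n))) (approx n (\<pi> s)) < \<delta>"
          using approx_lipschitz[of n "\<pi> s - 1 / real (Suc n)" "\<pi> s"] n by (simp add: dist_norm)
        then show "norm (f (\<pi> s) (approx n (\<pi> s - 1 / real (Suc n))) - ?g n s) \<le> \<epsilon>"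
          using d(2)[OF imageI[OF floor_in] approx_ball approx_ball] by (simp add: dist_norm less_imp_le)
      qed (use e in simp)
      also have "\<epsilon> * (clamp t - a) \<le> \<epsilon> * (b - a)"
        using e clamp(2)[of t] in_bounds(2)[OF d_in] by simp
      finally show "norm (approx n t - (u0 + ?I n)) \<le> \<epsilon> * (b - a)"
        using approx(2)[OF t, of n] by (simp add: delay_op_def)
    qed (use e a_le_b in auto)
    \<comment> \<open>Translation by \<open>u0\<close> is handled by subadditivity and costs nothing
      because \<open>\<mu> {u0} = 0\<close>.\<close>
    also have "\<mu> ((\<lambda>n. u0 + ?I n) ` {k..}) \<le> \<mu> ((\<lambda>n. u0) ` {k..}) + \<mu> (?I ` {k..})"
      by (rule add) (use bI in \<open>auto simp: image_constant_conv\<close>)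
    also have "(\<lambda>n. u0) ` {k..} = {u0}" by auto
    also have "\<mu> (?I ` {k..}) \<le> integral {a..clamp t} (\<lambda>s. w (\<pi> s) (tail_measure k (\<pi> s)))"
    proof (rule integral_le[OF _ _ approx_rhs_bound _ _ clamp(1)])
      have "equi_regulated ((\<lambda>g s. g (\<pi> s)) ` (\<lambda>y s. f s (y s)) ` approx ` {k..})"
        by (rule equi_regulated_floor[OF rhs_equi_rd]) (use approx_J in auto)
      then show "equi_regulated (?g ` {k..})" by (simp add: image_image)
      show "(\<lambda>s. w (\<pi> s) (tail_measure k (\<pi> s))) integrable_on {p..q}" for p q
        using w_comp_integrable tail_measure_range tail_measure_lipschitz by blast
      show "\<mu> ((\<lambda>n. ?g n s) ` {k..}) \<le> w (\<pi> s) (tail_measure k (\<pi> s))" for s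
      proof -
        have "(\<lambda>n. approx n (\<pi> s)) ` {k..} \<subseteq> cball u0 \<beta>" using approx_ball by blast
        from f_mu[OF floor_in _ this] show ?thesis by (simp add: tail_measure_def image_image)
      qed
    qed simp
    finally show ?thesis using e' by (simp add: mu_u0 mult.assoc)
  qed
  then show ?thesis using that by blast
qed

text \<open>The limit \<open>v\<close> inherits the bounds and the Lipschitz constant of the tail
  measures. By compactness of \<open>J\<close> the convergence is uniform, so the integral
  inequality passes to the limit without its error term, and \<open>v\<close> meets the hypotheses
  of Kamke uniqueness.\<close>

lemma tail_measure_tendsto_zero:
  assumes "t \<in> J" shows "(\<lambda>k. tail_measure k t) \<longlonglongrightarrow> 0"
proof -
  have dec: "decseq (\<lambda>k. tail_measure k t)" for t
    unfolding decseq_def tail_measure_def by (intro allI impI mono bounded_tail image_mono) auto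
  have "\<exists>l. (\<lambda>k. tail_measure k t) \<longlonglongrightarrow> l" for t
    using decseq_convergent[OF dec, of 0 t] tail_measure_range by (metis atLeastAtMost_iff)
  then obtain v where v: "\<And>t. (\<lambda>k. tail_measure k t) \<longlonglongrightarrow> v t" by metis
  have range: "v t \<in> {0..R}" for t
    using LIMSEQ_le_const[OF v] LIMSEQ_le_const2[OF v] tail_measure_range by (metis atLeastAtMost_iff)
  have lip: "\<bar>v s - v t\<bar> \<le> L * \<bar>s - t\<bar>" for s t
    using equi_lipschitz_limit[of tail_measure s t _ v] tail_measure_lipschitz v by (simp add: real_norm_def)
  let ?W = "\<lambda>t. integral {a..t} (\<lambda>s. w (\<pi> s) (v (\<pi> s)))"
  have int: "(\<lambda>s. w (\<pi> s) (v (\<pi> s))) integrable_on {p..q}" for p q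
    using w_comp_integrable range lip by blast
  have int_k: "(\<lambda>s. w (\<pi> s) (tail_measure k (\<pi> s))) integrable_on {p..q}" for k p q
    using w_comp_integrable tail_measure_range tail_measure_lipschitz by blast
  have le: "v t \<le> ?W (clamp t)" if t: "t \<le> b" for t
  proof (rule field_le_epsilon)
    fix \<eta> :: real assume "\<eta> > 0"
    then have e3: "\<eta> / 2 > 0" by simp
    define \<epsilon> where "\<epsilon> = \<eta> / 2 / (b - a + 1)"
    have e: "\<epsilon> > 0" "\<epsilon> * (b - a) \<le> \<eta> / 2" using e3 a_le_b by (auto simp: \<epsilon>_def field_simps)
    obtain \<delta> where d: "\<delta> > 0" "\<And>g x y. g \<in> w ` J \<Longrightarrow> x \<in> {0..R} \<Longrightarrow> y \<in> {0..R} \<Longrightarrow>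
        dist x y < \<delta> \<Longrightarrow> dist (g x) (g y) < \<epsilon>"
      using uniformly_equicontinuous_onE[OF w_equi[OF R_pos] e(1)] by blast
    have "\<forall>\<^sub>F k in sequentially. \<forall>s\<in>J. norm (tail_measure k s - v s) < \<delta>"
      using tail_measure_lipschitz v
      by (intro equi_lipschitz_uniform_limit[OF compact_J L_nonneg _ _ d(1)]) (auto simp: real_norm_def)
    then obtain N1 where N1: "\<And>k s. k \<ge> N1 \<Longrightarrow> s \<in> J \<Longrightarrow> norm (tail_measure k s - v s) < \<delta>"
      unfolding eventually_sequentially by blast
    obtain N2 where N2: "\<And>k t. k \<ge> N2 \<Longrightarrow> t \<le> b \<Longrightarrow>
        tail_measure k t \<le> integral {a..clamp t} (\<lambda>s. w (\<pi> s) (tail_measure k (\<pi> s))) + \<eta> / 2"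
      using tail_measure_le[OF e3] by blast
    let ?k = "max N1 N2"
    have "norm (integral {a..clamp t} (\<lambda>s. w (\<pi> s) (tail_measure ?k (\<pi> s))) - ?W (clamp t))
        \<le> \<epsilon> * (clamp t - a)"
    proof (rule norm_integral_diff_le[OF int_k int clamp(1)])
      fix s
      have "dist (tail_measure ?k (\<pi> s)) (v (\<pi> s)) < \<delta>"
        using N1[of ?k "\<pi> s"] floor_in by (simp add: dist_norm)
      then show "norm (w (\<pi> s) (tail_measure ?k (\<pi> s)) - w (\<pi> s) (v (\<pi> s))) \<le> \<epsilon>"
        using d(2)[OF imageI[OF floor_in] tail_measure_range range] by (simp add: dist_norm less_imp_le)
    qed (use e in simp)
    also have "\<epsilon> * (clamp t - a) \<le> \<epsilon> * (b - a)"
      using e clamp(2)[of t] in_bounds(2)[OF d_in] by simp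
    finally have "integral {a..clamp t} (\<lambda>s. w (\<pi> s) (tail_measure ?k (\<pi> s))) \<le> ?W (clamp t) + \<eta> / 2"
      using e(2) by (simp add: real_norm_def)
    moreover have "v t \<le> tail_measure ?k t" using decseq_ge[OF dec v] .
    ultimately show "v t \<le> ?W (clamp t) + \<eta>" using N2[of ?k t] t by simp
  qed
  \<comment> \<open>Non-negativity of \<open>w\<close> extends the integral from
    \<open>clamp t\<close> to \<open>t\<close>, giving the inequality on all of [a,b] as the Kamke
    condition requires.\<close>
  have W_mono: "?W (clamp t) \<le> ?W t" if "t \<in> J" for t
  proof (rule integral_subset_le[OF _ int int])
    show "{a..clamp t} \<subseteq> {a..t}" using clamp(4)[of t] in_bounds[OF that] by auto
    show "\<forall>s\<in>{a..t}. 0 \<le> w (\<pi> s) (v (\<pi> s))" using w_nonneg[OF floor_in] range by auto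
  qed
  have vW: "v t \<le> ?W t" if "t \<in> J" for t
    using le[of t] W_mono[OF that] in_bounds[OF that] by simp
  have va: "v a = 0" using vW[OF a_in] range[of a] by simp
  have rd: "equi_rd_at J {\<lambda>s. w s (v s)} t" if "t \<in> J" for t
    using w_comp_equi_rd[OF _ _ R_pos L_nonneg that] range lip by blast
  \<comment> \<open>The majorant \<open>?W\<close> has derivative
    \<open>w a (v a) = w a 0 = 0\<close> at \<open>a\<close>; since
    \<open>0 \<le> v \<le> ?W\<close> with equality to 0 at \<open>a\<close>, this passes to
    \<open>v\<close>.\<close>
  have der: "has_delta_derivative J v 0 a"
    unfolding has_delta_derivative_def
  proof (intro allI impI)
    fix \<epsilon> :: real assume e: "\<epsilon> > 0"
    let ?\<sigma> = "ts_sigma J a"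
    have "has_delta_derivative J ?W 0 a"
      using floor_integral_has_delta_derivative[OF rd a_in] w_zero[OF a_in] va by simp
    then obtain \<delta> where d: "\<delta> > 0" "\<And>s. s \<in> ts_ball J \<delta> a \<Longrightarrow>
        norm (?W ?\<sigma> - ?W s - (?\<sigma> - s) *\<^sub>R 0) \<le> \<epsilon> * \<bar>?\<sigma> - s\<bar>"
      using e unfolding has_delta_derivative_def by meson
    show "\<exists>\<delta>>0. \<forall>s\<in>ts_ball J \<delta> a. norm (v ?\<sigma> - v s - (?\<sigma> - s) *\<^sub>R 0) \<le> \<epsilon> * \<bar>?\<sigma> - s\<bar>"
    proof (cases "?\<sigma> = a")
      case True
      show ?thesis
      proof (intro exI[of _ \<delta>] conjI ballI)
        fix s assume s: "s \<in> ts_ball J \<delta> a"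
        then have sJ: "s \<in> J" by (simp add: ts_ball_def)
        have "\<bar>?W s\<bar> \<le> \<epsilon> * \<bar>a - s\<bar>" using d(2)[OF s] True by (simp add: real_norm_def)
        then show "norm (v ?\<sigma> - v s - (?\<sigma> - s) *\<^sub>R 0) \<le> \<epsilon> * \<bar>?\<sigma> - s\<bar>"
          using vW[OF sJ] range[of s] True va by (simp add: real_norm_def)
      qed (use d in simp)
    next
      \<comment> \<open>Within distance \<open>?\<sigma> - a\<close> the only point of
        \<open>J\<close> is \<open>a\<close> itself, so the condition reduces to a bound on
        \<open>v\<close> at the jump.\<close>
      case False
      then have sig: "a < ?\<sigma>" using sigma_ge[OF a_in] by simp
      show ?thesis
      proof (intro exI[of _ "min \<delta> (?\<sigma> - a)"] conjI ballI)
        fix s assume s: "s \<in> ts_ball J (min \<delta> (?\<sigma> - a)) a"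
        then have "s = a"
          using sigma_le[of s a] in_bounds(1)[of s] by (force simp: ts_ball_def)
        moreover have "\<bar>?W ?\<sigma>\<bar> \<le> \<epsilon> * \<bar>?\<sigma> - a\<bar>"
          using d(2)[of a] d(1) a_in by (simp add: ts_ball_def)
        ultimately show "norm (v ?\<sigma> - v s - (?\<sigma> - s) *\<^sub>R 0) \<le> \<epsilon> * \<bar>?\<sigma> - s\<bar>"
          using vW[OF sigma_in[OF a_in]] range[of ?\<sigma>] va by (simp add: real_norm_def)
      qed (use d sig in simp)
    qed
  qed
  have "v t = 0"
  proof (rule w_unique[OF _ _ _ der assms])
    have "L-lipschitz_on J v" using lip L_nonneg by (intro lipschitz_onI) (auto simp: dist_real_def)
    then show "continuous_on J v" by (rule lipschitz_on_continuous_on)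
    show "v t \<ge> 0" for t using range[of t] by simp
    show "v t \<le> delta_integral J a t (\<lambda>s. w s (v s))" if "t \<in> J" for t
      using vW[OF that] delta_integral_eq[OF rd that] by simp
  qed
  then show ?thesis using v[of t] by simp
qed

text \<open>Vanishing tail measures give a subsequence converging at every point of
  \<open>J\<close>, uniformly by the common Lipschitz bound. Equicontinuity of \<open>f\<close> then
  lets the limit pass under the integral.\<close>

lemma integral_equation_solution:
  obtains y where "admissible J y" "\<And>t. t \<in> J \<Longrightarrow> y t = u0 + integral {a..clamp t} (\<lambda>s. f (\<pi> s) (y (\<pi> s)))"
proof -
  obtain r :: "nat \<Rightarrow> nat" where r: "strict_mono r" "\<And>t. t \<in> J \<Longrightarrow> convergent (\<lambda>j. approx (r j) t)"
    using equi_lipschitz_convergent_subseq[of M J approx] M_pos approx_lipschitz bounded_tail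
      tail_measure_tendsto_zero unfolding tail_measure_def by (metis less_imp_le)
  define y where "y t = lim (\<lambda>j. approx (r j) t)" for t
  have y: "(\<lambda>j. approx (r j) t) \<longlonglongrightarrow> y t" if "t \<in> J" for t
    using r(2)[OF that] by (simp add: y_def convergent_LIMSEQ_iff)
  have adm: "admissible J y"
    unfolding admissible_def
  proof (intro conjI ballI)
    show "y s \<in> cball u0 \<beta>" if "s \<in> J" for s
      using closed_sequentially[OF closed_cball _ y[OF that]] approx_ball by blast
    show "norm (y s - y t) \<le> M * \<bar>s - t\<bar>" if "s \<in> J" "t \<in> J" for s t
      using equi_lipschitz_limit[of "\<lambda>j. approx (r j)" s t _ y] approx_lipschitz y that by blast
  qed
  have "y t = u0 + integral {a..clamp t} (\<lambda>s. f (\<pi> s) (y (\<pi> s)))" if t: "t \<in> J" for t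
  proof (rule LIMSEQ_unique[OF y[OF t]], rule metric_LIMSEQ_I)
    fix \<eta> :: real assume "\<eta> > 0"
    define \<epsilon> where "\<epsilon> = \<eta> / (b - a + 1)"
    have e: "\<epsilon> > 0" "\<epsilon> * (b - a) < \<eta>" using \<open>\<eta> > 0\<close> a_le_b by (auto simp: \<epsilon>_def field_simps)
    obtain \<delta> where d: "\<delta> > 0" "\<And>g x y. g \<in> f ` J \<Longrightarrow> x \<in> cball u0 \<beta> \<Longrightarrow> y \<in> cball u0 \<beta> \<Longrightarrow>
        dist x y < \<delta> \<Longrightarrow> dist (g x) (g y) < \<epsilon>"
      using uniformly_equicontinuous_onE[OF f_equi e(1)] by blast
    then have "\<delta> / 2 > 0" by simp
    have "\<forall>\<^sub>F j in sequentially. \<forall>s\<in>J. norm (approx (r j) s - y s) < \<delta> / 2"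
      using approx_lipschitz y M_pos
      by (intro equi_lipschitz_uniform_limit[OF compact_J, of M] \<open>\<delta> / 2 > 0\<close>) auto
    then obtain N1 where N1: "\<And>j s. j \<ge> N1 \<Longrightarrow> s \<in> J \<Longrightarrow> norm (approx (r j) s - y s) < \<delta> / 2"
      unfolding eventually_sequentially by blast
    obtain N2 where N2: "\<And>n. n \<ge> N2 \<Longrightarrow> M * (1 / real (Suc n)) < \<delta> / 2"
      using delay_small[OF \<open>\<delta> / 2 > 0\<close>] by blast
    have "dist (approx (r j) t) (u0 + integral {a..clamp t} (\<lambda>s. f (\<pi> s) (y (\<pi> s)))) < \<eta>"
      if j: "j \<ge> max N1 N2" for j
    proof -
      let ?n = "r j"
      have "j \<le> ?n" using seq_suble[OF r(1)] .
      let ?h = "1 / real (Suc ?n)"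
      have "norm (integral {a..clamp t} (\<lambda>s. f (\<pi> s) (approx ?n (\<pi> s - ?h)))
          - integral {a..clamp t} (\<lambda>s. f (\<pi> s) (y (\<pi> s)))) \<le> \<epsilon> * (clamp t - a)"
      proof (rule norm_integral_diff_le[OF _ _ clamp(1)])
        show "(\<lambda>s. f (\<pi> s) (approx ?n (\<pi> s - ?h))) integrable_on {a..clamp t}"
          using rhs_integrable[OF admissible_delay[OF approx(1)]] .
        show "(\<lambda>s. f (\<pi> s) (y (\<pi> s))) integrable_on {a..clamp t}" using rhs_integrable[OF adm] .
        fix s
        \<comment> \<open>Convergence is known on \<open>J\<close> only, and
          \<open>\<pi> s - ?h\<close> may lie outside \<open>J\<close>; the Lipschitz bound first
          moves the argument to \<open>\<pi> s\<close>, at the price of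
          \<open>\<delta> / 2\<close>.\<close>
        have "norm (approx ?n (\<pi> s - ?h) - approx ?n (\<pi> s)) \<le> M * ?h"
          using approx_lipschitz[of ?n "\<pi> s - ?h" "\<pi> s"] by simp
        also have "\<dots> < \<delta> / 2" using N2[of ?n] \<open>j \<le> ?n\<close> j by simp
        finally have "norm (approx ?n (\<pi> s - ?h) - approx ?n (\<pi> s)) < \<delta> / 2" .
        moreover have "norm (approx ?n (\<pi> s) - y (\<pi> s)) < \<delta> / 2" using N1[OF _ floor_in] j by simp
        ultimately have "dist (approx ?n (\<pi> s - ?h)) (y (\<pi> s)) < \<delta>"
          using dist_triangle_half_l[of _ _ \<delta>] unfolding dist_norm[symmetric]
          by (metis dist_commute dist_triangle_half_r)
        moreover have "y (\<pi> s) \<in> cball u0 \<beta>" using adm floor_in by (auto simp: admissible_def)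
        ultimately show "norm (f (\<pi> s) (approx ?n (\<pi> s - ?h)) - f (\<pi> s) (y (\<pi> s))) \<le> \<epsilon>"
          using d(2)[OF imageI[OF floor_in] approx_ball] by (simp add: dist_norm less_imp_le)
      qed (use e in simp)
      also have "\<epsilon> * (clamp t - a) \<le> \<epsilon> * (b - a)"
        using e clamp(2)[of t] in_bounds(2)[OF d_in] by simp
      also have "\<dots> < \<eta>" by (rule e(2))
      finally show ?thesis
        using approx(2)[of t ?n] in_bounds(2)[OF t] by (simp add: dist_norm delay_op_def)
    qed
    then show "\<exists>N. \<forall>j\<ge>N. dist (approx (r j) t) (u0 + integral {a..clamp t} (\<lambda>s. f (\<pi> s) (y (\<pi> s)))) < \<eta>"
      by blast
  qed
  then show ?thesis using that adm by blast
qed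

end

section \<open>From the integral equation to a solution up to the jump of \<open>d\<close>\<close>

context kamke_ivp
begin

text \<open>Cutting the time scale at \<open>ts_sigma J d\<close> can alter only the new end point:
  its jump becomes itself, so it may turn right-dense. If it differs from \<open>d\<close>, it is
  isolated in the cut time scale and a left-scattered maximum, hence outside
  \<open>ts_kappa\<close>; \<open>C1_rd\<close> nevertheless asks for a derivative there.\<close>

lemma local_solution_exists:
  assumes J: "J = ts_interval T a b"
  shows "\<exists>u. local_solution T a (ts_sigma J d) (cball u0 \<beta>) f u0 u"
proof -
  let ?c = "ts_sigma J d"
  let ?J = "ts_interval T a ?c"
  have cJ: "?c \<in> J" and dc: "d \<le> ?c" using sigma_in[OF d_in] sigma_ge[OF d_in] by auto
  have J': "?J = {t \<in> J. t \<le> ?c}" using in_bounds[OF cJ] by (auto simp: J ts_interval_def)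
  interpret J': compact_time_scale ?J a ?c
  proof
    have "{t \<in> J. t \<le> ?c} = J \<inter> {..?c}" by auto
    then show "closed ?J" unfolding J' using closed by (simp add: closed_Int)
    show "?J \<subseteq> {a..?c}" by (auto simp: ts_interval_def)
    show "a \<in> ?J" "?c \<in> ?J" using a_in cJ in_bounds[OF cJ] by (auto simp: J')
  qed
  have sigma_eq: "ts_sigma ?J t = ts_sigma J t" if t: "t \<in> ?J" "t < ?c" for t
  proof (rule antisym)
    have tJ: "t \<in> J" using t by (simp add: J')
    show "ts_sigma J t \<le> ts_sigma ?J t"
    proof (cases "right_dense ?J t")
      case True
      show ?thesis
      proof (rule ccontr)
        assume "\<not> ts_sigma J t \<le> ts_sigma ?J t"
        then have "ts_sigma J t - t > 0" using J'.sigma_ge[OF t(1)] by simp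
        then obtain s where "s \<in> ?J" "t < s" "s < t + (ts_sigma J t - t)"
          using J'.right_dense_approx[OF True t] by blast
        then show False using sigma_le[of s t] by (simp add: J')
      qed
    next
      case False
      then have "t < ts_sigma ?J t" using J'.sigma_ge[OF t(1)] by (simp add: right_dense_def)
      then show ?thesis using sigma_le J'.sigma_in[OF t(1)] by (simp add: J')
    qed
    show "ts_sigma ?J t \<le> ts_sigma J t"
    proof (cases "right_dense J t")
      case True
      have "t < b" using t in_bounds[OF cJ] by simp
      show ?thesis
      proof (rule ccontr)
        assume n: "\<not> ts_sigma ?J t \<le> ts_sigma J t"
        then have "min ?c (ts_sigma ?J t) - t > 0" using sigma_ge[OF tJ] t by simp
        then obtain s where s: "s \<in> J" "t < s" "s < t + (min ?c (ts_sigma ?J t) - t)"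
          using right_dense_approx[OF True tJ \<open>t < b\<close>] by blast
        then show False using J'.sigma_le[of s t] by (simp add: J')
      qed
    next
      case False
      then have "t < ts_sigma J t" using sigma_ge[OF tJ] by (simp add: right_dense_def)
      moreover have "ts_sigma J t \<le> ?c" using sigma_le[OF cJ t(2)] .
      ultimately show ?thesis using J'.sigma_le sigma_in[OF tJ] by (simp add: J')
    qed
  qed
  have isolated: "t = ?c" if "t \<in> ?J" "d < t" for t
    using sigma_le[of t d] that by (force simp: J')
  obtain y where y: "admissible J y"
    "\<And>t. t \<in> J \<Longrightarrow> y t = u0 + integral {a..clamp t} (\<lambda>s. f (\<pi> s) (y (\<pi> s)))"
    using integral_equation_solution by blast
  \<comment> \<open>Unlike \<open>y\<close>, the function \<open>u\<close> integrates past
    \<open>d\<close> without the clamp; since the floor is \<open>d\<close> up to the jump, this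
    adds the explicit step. At the jump \<open>u\<close> may leave the ball, whereas
    \<open>y\<close> remains in it, so \<open>f t (y t)\<close> serves as derivative
    everywhere.\<close>
  define I where "I t = integral {a..t} (\<lambda>s. f (\<pi> s) (y (\<pi> s)))" for t
  define u where "u t = u0 + I t" for t
  have uy: "u t = y t" if "t \<in> J" "t \<le> d" for t
    using y(2)[OF that(1)] clamp(5)[of t] in_bounds[OF that(1)] that by (simp add: u_def I_def)
  have rd: "equi_rd_at J {\<lambda>s. f s (y s)} t" if "t \<in> J" for t
    using rhs_equi_rd_single[OF y(1) that] .
  have derJ: "has_delta_derivative J u (f t (y t)) t" if "t \<in> J" for t
    using floor_integral_has_delta_derivative[OF rd that]
    by (simp add: has_delta_derivative_def u_def I_def)
  have der: "has_delta_derivative ?J u (f t (y t)) t" if t: "t \<in> ?J" for t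
  proof (cases "ts_sigma ?J t = ts_sigma J t")
    case True
    have "ts_ball ?J \<delta> t \<subseteq> ts_ball J \<delta> t" for \<delta> by (auto simp: ts_ball_def J')
    then show ?thesis
      using derJ[of t] t unfolding has_delta_derivative_def True by (simp add: J') (meson subsetD)
  next
    \<comment> \<open>The jump operators differ at \<open>?c\<close> only, and only if
      \<open>d < ?c\<close>. Then a ball of radius \<open>?c - d\<close> contains no other point,
      and any vector is a derivative.\<close>
    case False
    then have tc: "t = ?c" using sigma_eq[OF t] J'.in_bounds[OF t] by force
    have "d \<noteq> ?c" using False tc J'.sigma_b by metis
    then have "d < ?c" using dc by simp
    have only: "s = t" if "s \<in> ts_ball ?J (?c - d) t" for s
      using that isolated[of s] tc by (auto simp: ts_ball_def)
    have "norm (u (ts_sigma ?J t) - u s - (ts_sigma ?J t - s) *\<^sub>R f t (y t)) = 0"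
      if "s \<in> ts_ball ?J (?c - d) t" for s
      unfolding only[OF that] tc J'.sigma_b by simp
    then show ?thesis
      using \<open>d < ?c\<close> unfolding has_delta_derivative_def
      by (intro allI impI exI[of _ "?c - d"]) auto
  qed
  have restrict: "equi_rd_at ?J {g} t" if g: "equi_rd_at J {g} t" and t: "t \<in> ?J" for g :: "real \<Rightarrow> 'e" and t
    unfolding equi_rd_at_def
  proof (intro allI impI)
    fix \<epsilon> :: real assume e: "\<epsilon> > 0"
    obtain \<delta> where d: "\<delta> > 0"
      "\<And>s. right_dense J t \<Longrightarrow> s \<in> J \<Longrightarrow> \<bar>s - t\<bar> < \<delta> \<Longrightarrow> norm (g s - g t) < \<epsilon>"
      "\<And>s s'. s \<in> J \<Longrightarrow> s' \<in> J \<Longrightarrow> t - \<delta> < s \<Longrightarrow> s < t \<Longrightarrow> t - \<delta> < s' \<Longrightarrow> s' < t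
        \<Longrightarrow> norm (g s - g s') < \<epsilon>"
      using equi_rd_atE[OF g e] by (metis singletonI)
    \<comment> \<open>A point beyond \<open>d\<close> can only be \<open>?c\<close>, which may be
      right-dense in the cut time scale without being so in \<open>J\<close>; radius
      \<open>t - d\<close> isolates it, so nothing has to be shown about \<open>g\<close>.\<close>
    define \<eta> where "\<eta> = (if d < t then min \<delta> (t - d) else \<delta>)"
    have close: "norm (g s - g t) < \<epsilon>"
      if rdt: "right_dense ?J t" and s: "s \<in> ?J" "\<bar>s - t\<bar> < \<eta>" for s
    proof (cases "d < t")
      case True
      then have "t = ?c" "d < s" using isolated[OF t] s by (auto simp: \<eta>_def)
      then have "s = t" using isolated[OF s(1)] by simp
      then show ?thesis using e by simp
    next
      case False
      have "right_dense J t"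
      proof (cases "t < ?c")
        case True
        then show ?thesis using rdt sigma_eq[OF t] by (simp add: right_dense_def)
      next
        case False
        then have "t = d" "?c = d" using \<open>\<not> d < t\<close> dc by auto
        then show ?thesis by (simp add: right_dense_def)
      qed
      then show ?thesis using d(2) s False by (auto simp: \<eta>_def J')
    qed
    show "\<exists>\<delta>>0. \<forall>g\<in>{g}.
      (right_dense ?J t \<longrightarrow> (\<forall>s\<in>?J. \<bar>s - t\<bar> < \<delta> \<longrightarrow> norm (g s - g t) < \<epsilon>)) \<and>
      (\<forall>s\<in>?J. \<forall>s'\<in>?J. t - \<delta> < s \<and> s < t \<and> t - \<delta> < s' \<and> s' < t \<longrightarrow> norm (g s - g s') < \<epsilon>)"
    proof (intro exI[of _ \<eta>] conjI ballI impI)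
      show "\<eta> > 0" using d(1) by (simp add: \<eta>_def)
    next
      fix h s assume "h \<in> {g}" "right_dense ?J t" "s \<in> ?J" "\<bar>s - t\<bar> < \<eta>"
      then show "norm (h s - h t) < \<epsilon>" using close by simp
    next
      fix h s s' assume "h \<in> {g}" "s \<in> ?J" "s' \<in> ?J"
        "t - \<eta> < s \<and> s < t \<and> t - \<eta> < s' \<and> s' < t"
      then show "norm (h s - h s') < \<epsilon>"
        using d(3)[of s s'] by (auto simp: J' \<eta>_def split: if_splits)
    qed
  qed
  have rd': "rd_continuous_on ?J (\<lambda>s. f s (y s))"
    by (rule J'.equi_rd_at_imp_rd_continuous, rule restrict[OF rd]) (simp_all add: J')
  have "continuous_on ?J u"
  proof -
    have "(\<lambda>s. f (\<pi> s) (y (\<pi> s))) integrable_on {a..b}" using rhs_integrable[OF y(1)] .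
    then have "continuous_on {a..b} u"
      unfolding u_def I_def by (intro continuous_intros indefinite_integral_continuous_1)
    moreover have "?J \<subseteq> {a..b}" using in_bounds by (auto simp: J')
    ultimately show ?thesis by (rule continuous_on_subset)
  qed
  then have "u \<in> C1_rd ?J" using der rd'
    unfolding C1_rd_def by (intro CollectI conjI exI[of _ "\<lambda>t. f t (y t)"] ballI)
  moreover have "u t \<in> cball u0 \<beta> \<and> has_delta_derivative ?J u (f t (u t)) t" if t: "t \<in> ts_kappa ?J" for t
  proof -
    have tJ: "t \<in> ?J" using t by (simp add: ts_kappa_def)
    \<comment> \<open>Points of \<open>ts_kappa ?J\<close> cannot exceed \<open>d\<close>, so the
      value of \<open>u\<close> at the jump, possibly outside the ball, never enters the
      equation.\<close>
    have "t \<le> d"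
    proof (rule ccontr)
      assume "\<not> t \<le> d"
      then have tc: "t = ?c" "d < ?c" using isolated[OF tJ] by auto
      have "left_scattered ?J t"
      proof -
        have "d \<in> {s \<in> ?J. s < t}" using d_in tc by (simp add: J')
        then have ne: "{s \<in> ?J. s < t} \<noteq> {}" by blast
        have "s \<le> d" if "s \<in> {s \<in> ?J. s < t}" for s using that isolated[of s] tc by force
        then have "Sup {s \<in> ?J. s < t} \<le> d" using ne by (intro cSup_least) auto
        then have "Sup {s \<in> ?J. s < t} < t" using tc by simp
        then show ?thesis unfolding left_scattered_def ts_rho_def ts_sup_def if_not_P[OF ne] .
      qed
      then show False using t tJ tc J'.in_bounds by (auto simp: ts_kappa_def)
    qed
    then have "u t = y t" using uy tJ by (simp add: J')
    then show ?thesis using der[OF tJ] y(1) tJ by (simp add: admissible_def J')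
  qed
  moreover have "u a = u0" by (simp add: u_def I_def)
  ultimately have "local_solution T a ?c (cball u0 \<beta>) f u0 u"
    unfolding local_solution_def Let_def by blast
  then show ?thesis by (rule exI[of _ u])
qed

end

theorem theorem8:
  fixes T J :: "real set" and a b \<beta> M bstar :: real
    and u0 :: "'e::banach"
    and f :: "real \<Rightarrow> 'e \<Rightarrow> 'e"
    and \<mu> :: "'e set \<Rightarrow> real"
    and w :: "real \<Rightarrow> real \<Rightarrow> real"
  assumes "time_scale T" and "a \<in> T" and "b \<in> T" and "a \<le> b"
    and J: "J = ts_interval T a b"
    and "\<beta> > 0"
    and "sublinear_mnc \<mu>"
    and "kamke_delta T a b w"
    and i: "uniformly_rd_equicontinuous T a b ((\<lambda>x t. f t x) ` cball u0 \<beta>)"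
    and ii: "uniformly_equicontinuous_on (cball u0 \<beta>) (f ` J)"
    and iii: "M > 0" "\<forall>t\<in>J. \<forall>x \<in> cball u0 \<beta>. norm (f t x) \<le> M"
    and iv: "\<forall>t\<in>J. \<forall>X. X \<noteq> {} \<and> X \<subseteq> cball u0 \<beta> \<longrightarrow> \<mu> (f t ` X) \<le> w t (\<mu> X)"
    and v: "\<mu> {u0} = 0"
    and bstar: "bstar = ts_sup J {s \<in> J. ts_sigma J s \<le> min b (a + \<beta> / M)}"
  shows "bstar \<in> J \<and> (\<exists>u. local_solution T a (ts_sigma J bstar) (cball u0 \<beta>) f u0 u)"
proof -
  interpret compact_time_scale J a b
    using assms(1-4) by unfold_locales (auto simp: J ts_interval_def time_scale_def closed_Int)
  let ?S = "{s \<in> J. ts_sigma J s \<le> min b (a + \<beta> / M)}"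
  have "bstar \<in> J \<and> bstar \<le> a + \<beta> / M"
  proof (cases "?S = {}")
    case True
    \<comment> \<open>The set is empty when already the jump of \<open>a\<close> exceeds
      \<open>a + \<beta> / M\<close>. The default value of the supremum is then
      \<open>Inf J = a\<close>, and the solution consists of at most one explicit step from
      \<open>a\<close>.\<close>
    then have "bstar = a" unfolding bstar ts_sup_def by (simp add: Inf_J)
    then show ?thesis using a_in \<open>\<beta> > 0\<close> \<open>M > 0\<close> by simp
  next
    case False
    then have eq: "bstar = Sup ?S" unfolding bstar ts_sup_def by (simp only: if_False)
    have "Sup ?S \<in> J" by (rule closed_subset_contains_Sup[OF closed _ False bdd(1)]) auto
    \<comment> \<open>The supremum need not belong to the set, so the bound on the jump of
      \<open>s\<close> is weakened to one on \<open>s\<close> itself, which survives the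
      supremum.\<close>
    moreover have "Sup ?S \<le> a + \<beta> / M"
      using sigma_ge by (intro cSup_least[OF False]) force
    ultimately show ?thesis by (simp add: eq)
  qed
  then have bs: "bstar \<in> J" "M * (bstar - a) \<le> \<beta>" using \<open>M > 0\<close> by (auto simp: field_simps)
  note kamke = \<open>kamke_delta T a b w\<close>[unfolded kamke_delta_def Let_def, folded J]
  interpret kamke_ivp J a b \<mu> f u0 \<beta> M bstar w
  proof unfold_locales
    show "equi_rd_at J ((\<lambda>x t. f t x) ` cball u0 \<beta>) t" if "t \<in> J" for t
      using uniformly_rd_equicontinuous_imp_equi_rd_at[OF i J that] .
    show "v t = 0"
      if "continuous_on J v" "\<And>t. t \<in> J \<Longrightarrow> v t \<ge> 0"
        "\<And>t. t \<in> J \<Longrightarrow> v t \<le> delta_integral J a t (\<lambda>s. w s (v s))"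
        "has_delta_derivative J v 0 a" "t \<in> J" for v t
      using kamke that by blast
  qed (use bs iii ii iv \<open>\<mu> {u0} = 0\<close> kamke \<open>sublinear_mnc \<mu>\<close> in auto)
  show ?thesis using bs(1) local_solution_exists[OF J] by blast
qed

end
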